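(* Let $f$ be a transcendental entire function satisfying $$\operatorname{logarea}\left\{ z\in\Delta : \left|\frac{zf'(z)}{f(z)}\right| < n(|z|)^{1/2+\varepsilon}\ \text{ or }\ |f(z)| < (1+\varepsilon)|z| \right\} <\infty$$ for some $\varepsilon>0$. Then $$\operatorname{logarea}(\Delta\setminus I(f))<\infty.$$ In particular, $\operatorname{area} I(f)>0$. If, in addition, $F(f)$ does not have a multiply connected component, then $$\operatorname{logarea}(\Delta\setminus (I(f)\cap J(f)))<\infty$$ and thus $\operatorname{area}(I(f)\cap J(f))>0$.
   Context: For an entire function $f$ and $a\in\mathbb{C}$, $n(r,a)$ denotes the number of $a$-points of $f$ (solutions of $f(z)=a$, counted with multiplicity) in $\{z: |z|\le r\}$, and $n(r)=\max_{a\in\mathbb{C}} n(r,a)$. $f^n$ denotes the $n$-th iterate of $f$. The Fatou set $F(f)$ is the set of all $z\in\mathbb{C}$ at which the iterates $f^n$ form a normal family (i.e. they are normal in some neighborhood of $z$); the Julia set is $J(f)=\mathbb{C}\setminus F(f)$; the escaping set $I(f)$ is the set of all $z\in\mathbb{C}$ with $f^n(z)\to\infty$ as $n\to\infty$. A component of $F(f)$ is a connected component; it is multiply connected if it is not simply connected. $\operatorname{area} A$ is the two-dimensional Lebesgue measure of a measurable set $A\subset\mathbb{C}$, the logarithmic area is $\operatorname{logarea} A=\int_A \frac{dx\,dy}{|z|^2}$ (with $z=x+iy$), and $\Delta=\{z\in\mathbb{C}: |z|\ge 1\}$. *)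

theory Defs
  imports "HOL-Complex_Analysis.Complex_Analysis" "HOL-Computational_Algebra.Polynomial"
begin

definition transcendental_entire :: "(complex \<Rightarrow> complex) \<Rightarrow> bool" where
  "transcendental_entire f \<longleftrightarrow>
     f holomorphic_on UNIV \<and> \<not> (\<exists>p :: complex poly. \<forall>z. f z = poly p z)"

(* For nonconstant entire f the index set is finite and every zorder occurring here is
   positive, so the sum is the number of a-points with multiplicity. *)
definition num_pts :: "(complex \<Rightarrow> complex) \<Rightarrow> real \<Rightarrow> complex \<Rightarrow> nat" where
  "num_pts f r a = (\<Sum>z | cmod z \<le> r \<and> f z = a. nat (zorder (\<lambda>w. f w - a) z))"

(* For nonconstant entire f and fixed r the values num_pts f r a are bounded
   (as a function of a the count over a closed disk is upper semicontinuous and vanishes for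
   large a), so this is the maximum of a finite nonempty set. *)
definition max_num_pts :: "(complex \<Rightarrow> complex) \<Rightarrow> real \<Rightarrow> nat" where
  "max_num_pts f r = Max (range (num_pts f r))"

(* Normality in the sense of Montel, for holomorphic functions on a domain U: the constant
   limit infinity is allowed.  For connected U this is normality with respect to the
   spherical metric. *)
definition normal_family_on :: "complex set \<Rightarrow> (complex \<Rightarrow> complex) set \<Rightarrow> bool" where
  "normal_family_on U \<F> \<longleftrightarrow>
     (\<forall>h :: nat \<Rightarrow> complex \<Rightarrow> complex. range h \<subseteq> \<F> \<longrightarrow>
        (\<exists>r :: nat \<Rightarrow> nat. strict_mono r \<and>
           ((\<exists>g. g holomorphic_on U \<and>
                 (\<forall>K. compact K \<and> K \<subseteq> U \<longrightarrow> uniform_limit K (h \<circ> r) g sequentially)) \<or>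
            (\<forall>K. compact K \<and> K \<subseteq> U \<longrightarrow>
                 (\<forall>B :: real. \<forall>\<^sub>F n in sequentially. \<forall>z\<in>K. B \<le> cmod (h (r n) z))))))"

definition Fatou_set :: "(complex \<Rightarrow> complex) \<Rightarrow> complex set" where
  "Fatou_set f =
     {z. \<exists>U. open U \<and> connected U \<and> z \<in> U \<and> normal_family_on U (range (\<lambda>n. f ^^ n))}"

definition Julia_set :: "(complex \<Rightarrow> complex) \<Rightarrow> complex set" where
  "Julia_set f = UNIV - Fatou_set f"

definition escaping_set :: "(complex \<Rightarrow> complex) \<Rightarrow> complex set" where
  "escaping_set f = {z. filterlim (\<lambda>n. (f ^^ n) z) at_infinity sequentially}"

definition multiply_connected :: "complex set \<Rightarrow> bool" where
  "multiply_connected U \<longleftrightarrow> connected U \<and> \<not> simply_connected U"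

definition area :: "complex set \<Rightarrow> ennreal" where
  "area A = emeasure lebesgue A"

definition logarea :: "complex set \<Rightarrow> ennreal" where
  "logarea A = (\<integral>\<^sup>+z\<in>A. ennreal (1 / (cmod z)\<^sup>2) \<partial>lebesgue)"

definition Delta :: "complex set" where
  "Delta = {z. 1 \<le> cmod z}"

end

theory Submission
  imports Defs
begin

text \<open>
  The idea is that \<open>f\<close> expands logarithmic area more than its multiplicity can compensate. In
  logarithmic coordinates the derivative of \<open>f\<close> is \<open>z f'(z) / f(z)\<close>. Outside the exceptional set its
  modulus is at least \<open>n(\<bar>z\<bar>) powr (1/2 + \<epsilon>)\<close>, so logarithmic area grows by \<open>n(\<bar>z\<bar>) powr (1 + 2 \<epsilon>)\<close>,
  while no value is taken more than \<open>n(\<bar>z\<bar>)\<close> times in the disk of radius \<open>\<bar>z\<bar>\<close>. Sorting points by the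
  size of \<open>n(\<bar>z\<bar>)\<close> and summing a geometric series gives a radius \<open>R\<close> such that, outside the exceptional
  set and the disk of radius \<open>R\<close>, taking preimages under \<open>f\<close> at least halves the logarithmic area
  (\<open>preimage_contraction\<close>).

  A point of modulus at least \<open>R\<close> whose orbit never meets the exceptional set escapes, since its modulus
  grows by the factor \<open>1 + \<epsilon>\<close> in each step. The other points of modulus at least \<open>R\<close> have a first time at
  which their orbit meets the exceptional set. Those with first time \<open>j\<close> have logarithmic area at most
  \<open>(1/2)^j\<close> times that of the exceptional set, and the sum over \<open>j\<close> is finite (\<open>good_orbits_cofinite\<close>).
  Since \<open>Delta\<close> has infinite logarithmic area, the escaping set has positive area.

  Along these good orbits the factors \<open>\<bar>z f'(z) / f(z)\<bar>\<close> are at least 2, so the logarithmic derivatives of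
  the iterates are unbounded. If such a point belonged to the Fatou set and all components of the Fatou set
  were simply connected, a Koebe-type distortion bound, obtained from Bloch's theorem applied to the logarithm of
  the iterates, would keep these logarithmic derivatives bounded (\<open>expanding_escaping_in_Julia\<close>). Hence
  the good orbits start in the Julia set.
\<close>

section \<open>Area of holomorphic images\<close>

text \<open>
  Jacobian determinants refer to coordinates, so the area estimate for holomorphic functions is
  proved in \<open>real^2\<close> and carried over to the complex plane by the coordinate isomorphism, which
  preserves Lebesgue measure.
\<close>
definition of_vec2 :: "real^2 \<Rightarrow> complex" where
  "of_vec2 v = Complex (v $ 1) (v $ 2)"

definition to_vec2 :: "complex \<Rightarrow> real^2" where
  "to_vec2 z = vector [Re z, Im z]"

lemma of_to_vec2 [simp]: "of_vec2 (to_vec2 z) = z"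
  by (simp add: of_vec2_def to_vec2_def)

lemma to_of_vec2 [simp]: "to_vec2 (of_vec2 v) = v"
  by (simp add: of_vec2_def to_vec2_def vec_eq_iff forall_2)

lemma bounded_linear_of_vec2: "bounded_linear of_vec2"
  by (intro linear_conv_bounded_linear[THEN iffD1] linearI)
     (simp_all add: of_vec2_def complex_eq_iff)

lemma bounded_linear_to_vec2: "bounded_linear to_vec2"
  by (intro linear_conv_bounded_linear[THEN iffD1] linearI)
     (simp_all add: to_vec2_def vec_eq_iff forall_2)

lemma borel_of_vec2 [measurable]: "of_vec2 \<in> borel_measurable borel"
  by (intro borel_measurable_continuous_onI linear_continuous_on bounded_linear_of_vec2)

lemma lborel_distr_of_vec2: "lborel = distr lborel borel of_vec2"
proof (rule lborel_eqI)
  fix l u :: complex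
  assume le: "\<And>b. b \<in> Basis \<Longrightarrow> l \<bullet> b \<le> u \<bullet> b"
  have *: "of_vec2 -` box l u = box (to_vec2 l) (to_vec2 u)"
    by (auto simp: of_vec2_def to_vec2_def mem_box_cart forall_2 in_box_complex_iff)
  have "emeasure (distr lborel borel of_vec2) (box l u) = emeasure lborel (box (to_vec2 l) (to_vec2 u))"
    by (simp add: emeasure_distr *)
  also have "\<dots> = (\<Prod>b\<in>Basis. (to_vec2 u - to_vec2 l) \<bullet> b)"
    using le[of 1] le[of \<i>] by (intro emeasure_lborel_box)
     (auto simp: Basis_vec_def inner_axis to_vec2_def Basis_complex_def UNIV_2)
  also have "\<dots> = (\<Prod>b\<in>Basis. (u - l) \<bullet> b)"
    by (simp add: Basis_vec_def inner_axis to_vec2_def Basis_complex_def UNIV_2 axis_eq_axis mult.commute)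
  finally show "emeasure (distr lborel borel of_vec2) (box l u) = (\<Prod>b\<in>Basis. (u - l) \<bullet> b)" .
qed simp

lemma emeasure_of_vec2_vimage:
  "A \<in> sets borel \<Longrightarrow> emeasure lborel (of_vec2 -` A) = emeasure lborel A"
  using arg_cong[OF lborel_distr_of_vec2, of "\<lambda>M. emeasure M A"]
  by (simp add: emeasure_distr)

lemma det_complex_mult: "det (matrix (\<lambda>v. to_vec2 (c * of_vec2 v))) = (cmod c)\<^sup>2"
  by (simp add: det_2 matrix_def to_vec2_def of_vec2_def axis_def cmod_def power2_eq_square)

text \<open>
  The Jacobian of a holomorphic map is the squared modulus of its derivative. Applied to
  a local inverse of \<open>f\<close>, the estimate bounds the area of a set by the area of its image under \<open>f\<close>.
  If \<open>F\<close> has infinite area, positivity of \<open>B\<close> makes the bound trivial.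
\<close>
lemma emeasure_holomorphic_image_le:
  assumes g: "g holomorphic_on U" and U: "open U"
    and F: "F \<in> sets borel" "F \<subseteq> U" and gF: "g ` F \<in> sets borel"
    and B: "0 < B" "\<And>z. z \<in> F \<Longrightarrow> cmod (deriv g z) \<le> B"
  shows "emeasure lborel (g ` F) \<le> ennreal (B\<^sup>2) * emeasure lborel F"
proof (cases "emeasure lborel F = \<infinity>")
  case True
  then show ?thesis using B(1) by (simp add: ennreal_mult_top)
next
  case False
  define S where "S = of_vec2 -` F"
  define G where "G = (\<lambda>v. to_vec2 (g (of_vec2 v)))"
  define G' where "G' = (\<lambda>v h. to_vec2 (deriv g (of_vec2 v) * of_vec2 h))"
  have mS: "S \<in> sets borel"
    unfolding S_def by (rule measurable_sets_borel[OF borel_of_vec2 F(1)])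
  have eS: "emeasure lborel S = emeasure lborel F"
    unfolding S_def by (rule emeasure_of_vec2_vimage) fact
  have lmS: "S \<in> lmeasurable"
    using mS eS False by (intro fmeasurableI) (auto simp: less_top)
  have der: "(G has_derivative G' v) (at v within S)" if "v \<in> S" for v
  proof -
    have "of_vec2 v \<in> U" using that F(2) by (auto simp: S_def)
    then have "(g has_field_derivative deriv g (of_vec2 v)) (at (of_vec2 v))"
      using g U by (intro holomorphic_derivI)
    then have d: "(g has_derivative (*) (deriv g (of_vec2 v))) (at (of_vec2 v) within of_vec2 ` S)"
      by (simp add: has_field_derivative_def has_derivative_at_withinI)
    have "((\<lambda>v. to_vec2 (g (of_vec2 v))) has_derivative
            (\<lambda>h. to_vec2 (deriv g (of_vec2 v) * of_vec2 h))) (at v within S)"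
      by (intro bounded_linear.has_derivative[OF bounded_linear_to_vec2]
          has_derivative_in_compose[OF
            bounded_linear_imp_has_derivative[OF bounded_linear_of_vec2] d])
    then show ?thesis unfolding G_def G'_def .
  qed
  have detG: "\<bar>det (matrix (G' v))\<bar> = (cmod (deriv g (of_vec2 v)))\<^sup>2" for v
    by (simp add: G'_def det_complex_mult)
  have bd: "\<bar>det (matrix (G' v))\<bar> \<le> B\<^sup>2" if "v \<in> S" for v
    unfolding detG using that by (intro power_mono B(2)) (auto simp: S_def)
  have cont: "continuous_on U (deriv g)"
    using g U by (intro holomorphic_on_imp_continuous_on holomorphic_deriv)
  have "continuous_on (of_vec2 -` U) (\<lambda>v. (cmod (deriv g (of_vec2 v)))\<^sup>2)"
    by (intro continuous_intros continuous_on_compose2[OF cont]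
         linear_continuous_on bounded_linear_of_vec2) auto
  then have "continuous_on S (\<lambda>v. (cmod (deriv g (of_vec2 v)))\<^sup>2)"
    by (rule continuous_on_subset) (use F(2) in \<open>auto simp: S_def\<close>)
  then have "(\<lambda>v. (cmod (deriv g (of_vec2 v)))\<^sup>2) \<in> borel_measurable (lebesgue_on S)"
    using lmS by (intro continuous_imp_measurable_on_sets_lebesgue) auto
  then have int: "(\<lambda>v. \<bar>det (matrix (G' v))\<bar>) integrable_on S"
    unfolding detG
    by (rule measurable_bounded_by_integrable_imp_integrable[where g = "\<lambda>_. B\<^sup>2"])
       (use lmS bd detG in \<open>auto simp: integrable_on_const\<close>)
  note * = measurable_bounded_differentiable_image[OF lmS der int bd]
    measure_bounded_differentiable_image[OF lmS der int bd]
  have GS: "G ` S = of_vec2 -` (g ` F)"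
  proof (intro equalityI subsetI)
    fix v assume "v \<in> of_vec2 -` (g ` F)"
    then obtain z where "z \<in> F" "of_vec2 v = g z" by auto
    then have "G (to_vec2 z) = v"
      unfolding G_def by (metis to_of_vec2 of_to_vec2)
    moreover have "to_vec2 z \<in> S" using \<open>z \<in> F\<close> by (simp add: S_def)
    ultimately show "v \<in> G ` S" by blast
  qed (auto simp: G_def S_def)
  have mGS: "G ` S \<in> sets borel"
    unfolding GS by (rule measurable_sets_borel[OF borel_of_vec2 gF])
  have "emeasure lborel (g ` F) = emeasure lborel (G ` S)"
    unfolding GS by (rule emeasure_of_vec2_vimage[symmetric]) fact
  also have "\<dots> = ennreal (measure lebesgue (G ` S))"
    using *(1) mGS emeasure_eq_measure2[OF *(1)] by simp
  also have "\<dots> \<le> ennreal (B\<^sup>2 * measure lebesgue S)"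
    using *(2) by (rule ennreal_leI)
  also have "\<dots> = ennreal (B\<^sup>2) * emeasure lebesgue S"
    using lmS by (simp add: ennreal_mult emeasure_eq_measure2)
  also have "emeasure lebesgue S = emeasure lborel F"
    using eS mS by simp
  finally show ?thesis .
qed

section \<open>Logarithmic area and preimages\<close>
definition log_measure :: "complex measure" where
  "log_measure = density lborel (\<lambda>z. ennreal (1 / (cmod z)\<^sup>2))"

lemma sets_log_measure [simp, measurable_cong]: "sets log_measure = sets borel"
  and space_log_measure [simp]: "space log_measure = UNIV"
  by (simp_all add: log_measure_def)

lemma logarea_eq_emeasure: "A \<in> sets borel \<Longrightarrow> logarea A = emeasure log_measure A"
  unfolding logarea_def log_measure_def
  by (subst nn_integral_completion) (auto simp: emeasure_density)

lemma logarea_mono: "A \<subseteq> B \<Longrightarrow> logarea A \<le> logarea B"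
  unfolding logarea_def by (intro nn_integral_mono) (auto simp: indicator_def)

lemma log_measure_le_lborel:
  assumes "E \<in> sets borel" "0 < a" "\<And>z. z \<in> E \<Longrightarrow> a \<le> cmod z"
  shows "emeasure log_measure E \<le> ennreal (1 / a\<^sup>2) * emeasure lborel E"
proof -
  have "emeasure log_measure E = (\<integral>\<^sup>+z. ennreal (1 / (cmod z)\<^sup>2) * indicator E z \<partial>lborel)"
    unfolding log_measure_def using assms(1) by (simp add: emeasure_density)
  also have "\<dots> \<le> (\<integral>\<^sup>+z. ennreal (1 / a\<^sup>2) * indicator E z \<partial>lborel)"
    using assms by (intro nn_integral_mono)
      (auto simp: indicator_def intro!: ennreal_leI divide_left_mono power_mono mult_pos_pos zero_less_power dest: less_le_trans)
  also have "\<dots> = ennreal (1 / a\<^sup>2) * emeasure lborel E"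
    using assms(1) by (simp add: nn_integral_cmult_indicator)
  finally show ?thesis .
qed

lemma lborel_le_log_measure:
  assumes "E \<in> sets borel" "0 < b" "\<And>z. z \<in> E \<Longrightarrow> cmod z \<le> b" "0 \<notin> E"
  shows "emeasure lborel E \<le> ennreal (b\<^sup>2) * emeasure log_measure E"
proof -
  have *: "1 \<le> b\<^sup>2 * (1 / (cmod z)\<^sup>2)" if "z \<in> E" for z
  proof -
    have "z \<noteq> 0" "cmod z \<le> b" using assms that by auto
    then show ?thesis by (simp add: power_mono)
  qed
  have "emeasure lborel E = (\<integral>\<^sup>+z. indicator E z \<partial>lborel)"
    using assms(1) by simp
  also have "\<dots> \<le> (\<integral>\<^sup>+z. ennreal (b\<^sup>2) * (ennreal (1 / (cmod z)\<^sup>2) * indicator E z) \<partial>lborel)"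
    using * by (intro nn_integral_mono)
      (auto simp: indicator_def ennreal_mult[symmetric] simp flip: ennreal_1 intro!: ennreal_leI)
  also have "\<dots> = ennreal (b\<^sup>2) * emeasure log_measure E"
    unfolding log_measure_def using assms(1)
    by (simp add: emeasure_density nn_integral_cmult)
  finally show ?thesis .
qed

lemma inverse_image_borel:
  fixes f g :: "complex \<Rightarrow> complex"
  assumes "open V" "continuous_on V g" "E \<in> sets borel"
  shows "{w \<in> V. g w \<in> E} \<in> sets borel"
proof -
  have "g \<in> borel_measurable (restrict_space borel V)"
    by (rule borel_measurable_continuous_on_restrict) fact
  from measurable_sets[OF this assms(3)]
  have "g -` E \<inter> V \<in> sets (restrict_space borel V)"
    by (simp add: space_restrict_space)
  then have "g -` E \<inter> V \<in> sets borel"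
    using assms(1) by (subst (asm) sets_restrict_space_iff) auto
  also have "g -` E \<inter> V = {w \<in> V. g w \<in> E}" by auto
  finally show ?thesis .
qed

text \<open>
  In logarithmic coordinates \<open>f\<close> has derivative \<open>z f'(z) / f(z)\<close>, so where this has modulus at
  least \<open>\<kappa>\<close> the map expands logarithmic area by a factor \<open>\<kappa>\<^sup>2\<close>. Near a single point the exact
  density can be replaced by constants: on a small disk each of \<open>\<bar>z\<bar>\<close>, \<open>\<bar>f z\<bar>\<close> and
  \<open>\<bar>f' z\<bar>\<close> is within a factor 2 of its value at the centre. The constant \<open>4096\<close> is the loss
  caused by this; only its independence of the point matters.
\<close>
lemma log_measure_image_local:
  assumes f: "f holomorphic_on S" and S: "open S" "z0 \<in> S"
    and nz: "z0 \<noteq> 0" "f z0 \<noteq> 0" "deriv f z0 \<noteq> 0"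
  obtains r where "r > 0"
    "\<And>E. E \<in> sets borel \<Longrightarrow> E \<subseteq> ball z0 r \<Longrightarrow> f ` E \<in> sets borel"
    "\<And>E \<kappa>. \<lbrakk>E \<in> sets borel; E \<subseteq> ball z0 r; 0 \<le> \<kappa>;
        \<And>z. z \<in> E \<Longrightarrow> \<kappa> \<le> cmod (z * deriv f z / f z)\<rbrakk>
        \<Longrightarrow> ennreal (\<kappa>\<^sup>2) * emeasure log_measure E \<le> 4096 * emeasure log_measure (f ` E)"
proof -
  define c d m where "c = cmod z0" and "d = cmod (f z0)" and "m = cmod (deriv f z0)"
  have pos: "c > 0" "d > 0" "m > 0"
    using nz by (auto simp: c_def d_def m_def)
  obtain r1 where r1: "r1 > 0" "ball z0 r1 \<subseteq> S" "inj_on f (ball z0 r1)"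
    using has_complex_derivative_locally_injective[OF f S(2,1) nz(3)] by metis
  have near: "\<forall>\<^sub>F z in nhds z0. cmod (h z) < 2 * cmod (h z0) \<and> cmod (h z0) / 2 < cmod (h z)"
    if "isCont h z0" "h z0 \<noteq> 0" for h :: "complex \<Rightarrow> complex"
  proof -
    have "((\<lambda>z. cmod (h z)) \<longlongrightarrow> cmod (h z0)) (nhds z0)"
      using that(1) by (intro tendsto_norm) (simp add: isCont_def tendsto_nhds_iff)
    moreover have "cmod (h z0) < 2 * cmod (h z0)" "cmod (h z0) / 2 < cmod (h z0)"
      using that(2) by auto
    ultimately show ?thesis
      by (intro eventually_conj; elim order_tendstoD)
  qed
  have cf: "isCont f z0"
    using holomorphic_on_imp_continuous_on[OF f] continuous_on_eq_continuous_at[OF S(1)] S(2) by blast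
  have cf': "isCont (deriv f) z0"
    using holomorphic_on_imp_continuous_on[OF holomorphic_deriv[OF f S(1)]]
      continuous_on_eq_continuous_at[OF S(1)] S(2) by blast
  have "\<forall>\<^sub>F z in nhds z0. (cmod z < 2 * c \<and> c / 2 < cmod z) \<and> (cmod (f z) < 2 * d \<and> d / 2 < cmod (f z))
     \<and> (cmod (deriv f z) < 2 * m \<and> m / 2 < cmod (deriv f z))"
    unfolding c_def d_def m_def using near[OF cf nz(2)] near[OF cf' nz(3)] near[OF continuous_ident nz(1)]
    by (simp only: eventually_conj_iff)
  then obtain r2 where r2: "r2 > 0" and est: "\<And>z. dist z z0 < r2 \<Longrightarrow>
     cmod z < 2 * c \<and> c / 2 < cmod z \<and> cmod (f z) < 2 * d \<and> d / 2 < cmod (f z)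
     \<and> cmod (deriv f z) < 2 * m \<and> m / 2 < cmod (deriv f z)"
    unfolding eventually_nhds_metric by blast
  define r where "r = min r1 r2"
  define V where "V = f ` ball z0 r"
  have r: "r > 0" "ball z0 r \<subseteq> ball z0 r1" "ball z0 r \<subseteq> S"
    using r1 r2 by (auto simp: r_def)
  have hf: "f holomorphic_on ball z0 r" and inj: "inj_on f (ball z0 r)"
    using r f r1(3) by (auto intro: holomorphic_on_subset inj_on_subset)
  obtain g where g: "g holomorphic_on V" "\<And>z. z \<in> ball z0 r \<Longrightarrow> deriv f z * deriv g (f z) = 1"
      "\<And>z. z \<in> ball z0 r \<Longrightarrow> g (f z) = z"
    unfolding V_def using holomorphic_has_inverse[OF hf open_ball inj] by metis
  have V: "open V"
    unfolding V_def by (rule open_mapping_thm3[OF hf open_ball inj])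
  have img: "f ` E = {w \<in> V. g w \<in> E}" if "E \<subseteq> ball z0 r" for E
    using that g(3) by (force simp: V_def)
  have meas: "f ` E \<in> sets borel" if "E \<in> sets borel" "E \<subseteq> ball z0 r" for E
    unfolding img[OF that(2)]
    by (intro inverse_image_borel V that holomorphic_on_imp_continuous_on g)
  show thesis
  proof (rule that[OF r(1) meas], assumption+)
    fix E and \<kappa> :: real
    assume E: "E \<in> sets borel" "E \<subseteq> ball z0 r" and \<kappa>: "0 \<le> \<kappa>"
      "\<And>z. z \<in> E \<Longrightarrow> \<kappa> \<le> cmod (z * deriv f z / f z)"
    have bd: "cmod z < 2 * c" "c / 2 < cmod z" "cmod (f z) < 2 * d" "d / 2 < cmod (f z)"
        "cmod (deriv f z) < 2 * m" "m / 2 < cmod (deriv f z)" if "z \<in> E" for z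
      using est[of z] that E(2) by (auto simp: r_def dist_commute)
    show "ennreal (\<kappa>\<^sup>2) * emeasure log_measure E \<le> 4096 * emeasure log_measure (f ` E)"
    proof (cases "E = {}")
      case False
      then obtain z where z: "z \<in> E" by auto
      have "\<kappa> \<le> cmod z * cmod (deriv f z) / cmod (f z)"
        using \<kappa>(2)[OF z] by (simp add: norm_mult norm_divide)
      also have "\<dots> \<le> (2 * c) * (2 * m) / (d / 2)"
        using bd[OF z] pos by (intro frac_le mult_mono) auto
      finally have k1: "\<kappa> \<le> 8 * c * m / d" by (simp add: field_simps)
      \<comment> \<open>The four factors come from \<open>\<kappa>\<close>, from the density at \<open>E\<close>, from the area of the
        inverse image, and from the density at \<open>f ` E\<close>; together they are at most \<open>(8 * 8)\<^sup>2\<close>.\<close>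
      have k2: "\<kappa>\<^sup>2 * (1 / (c / 2)\<^sup>2) * (2 / m)\<^sup>2 * (2 * d)\<^sup>2 \<le> 4096"
      proof -
        have "\<kappa>\<^sup>2 * (1 / (c / 2)\<^sup>2) * (2 / m)\<^sup>2 * (2 * d)\<^sup>2 = (\<kappa> * (8 * d / (c * m)))\<^sup>2"
          using pos by (simp add: field_simps power2_eq_square)
        also have "\<dots> \<le> (8 * c * m / d * (8 * d / (c * m)))\<^sup>2"
          using pos k1 \<kappa>(1) by (intro power_mono mult_right_mono) auto
        also have "8 * c * m / d * (8 * d / (c * m)) = 64" using pos by (simp add: field_simps)
        finally show ?thesis by simp
      qed
      have "emeasure log_measure E \<le> ennreal (1 / (c / 2)\<^sup>2) * emeasure lborel E"
        using E pos bd by (intro log_measure_le_lborel) (auto intro: less_imp_le)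
      also have "emeasure lborel E = emeasure lborel (g ` f ` E)"
        using E g(3) by (subst image_image) (auto intro!: arg_cong[where f = "emeasure lborel"] simp: image_iff subset_eq)
      also have "\<dots> \<le> ennreal ((2 / m)\<^sup>2) * emeasure lborel (f ` E)"
      proof (rule emeasure_holomorphic_image_le[OF g(1) V])
        show "f ` E \<in> sets borel" by (rule meas) fact+
        show "f ` E \<subseteq> V" using E by (auto simp: V_def)
        have "g ` f ` E = E" using E g(3) by force
        then show "g ` f ` E \<in> sets borel" using E by simp
        show "0 < 2 / m" using pos by simp
        fix w assume "w \<in> f ` E"
        then obtain x where x: "x \<in> E" "w = f x" by auto
        have "deriv f x * deriv g w = 1" using g(2)[of x] x E by auto
        then have "cmod (deriv f x) * cmod (deriv g w) = 1" by (metis norm_mult norm_one)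
        moreover have big: "m / 2 < cmod (deriv f x)" using bd x by auto
        ultimately have "cmod (deriv g w) = 1 / cmod (deriv f x)"
          using pos by (subst nonzero_eq_divide_eq) (auto simp: mult.commute)
        also have "\<dots> \<le> 1 / (m / 2)" using big pos by (intro frac_le) auto
        finally show "cmod (deriv g w) \<le> 2 / m" by simp
      qed
      also have "emeasure lborel (f ` E) \<le> ennreal ((2 * d)\<^sup>2) * emeasure log_measure (f ` E)"
      proof (rule lborel_le_log_measure)
        show "0 \<notin> f ` E" using bd(4) pos by force
      qed (use pos bd meas[OF E] in \<open>auto intro: less_imp_le\<close>)
      finally have "emeasure log_measure E \<le> ennreal (1 / (c / 2)\<^sup>2) * (ennreal ((2 / m)\<^sup>2) *
         (ennreal ((2 * d)\<^sup>2) * emeasure log_measure (f ` E)))"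
        by (simp add: mult_left_mono)
      then have "ennreal (\<kappa>\<^sup>2) * emeasure log_measure E \<le> ennreal (\<kappa>\<^sup>2) *
         (ennreal (1 / (c / 2)\<^sup>2) * (ennreal ((2 / m)\<^sup>2) *
         (ennreal ((2 * d)\<^sup>2) * emeasure log_measure (f ` E))))"
        by (rule mult_left_mono) simp
      also have "\<dots> = ennreal (\<kappa>\<^sup>2 * (1 / (c / 2)\<^sup>2) * (2 / m)\<^sup>2 * (2 * d)\<^sup>2) * emeasure log_measure (f ` E)"
      proof -
        have *: "ennreal u * (ennreal v * (ennreal w * (ennreal x * y))) = ennreal (u * v * w * x) * y"
          if "0 \<le> u" "0 \<le> v" "0 \<le> w" "0 \<le> x" for u v w x y
          using that by (simp add: ennreal_mult mult.assoc)
        show ?thesis by (rule *) auto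
      qed
      also have "\<dots> \<le> ennreal 4096 * emeasure log_measure (f ` E)"
        using k2 by (intro mult_right_mono ennreal_leI) auto
      finally show ?thesis by simp
    qed simp
  qed
qed

text \<open>
  A point of the image is counted once for every piece \<open>D i\<close> that contains a preimage of it; since
  the pieces are disjoint these preimages are distinct, so there are at most \<open>N\<close> of them.
\<close>
lemma sum_indicator_images_le:
  fixes f :: "'a \<Rightarrow> 'b" and D :: "nat \<Rightarrow> 'a set"
  assumes disj: "disjoint_family D" and DE: "\<And>i. D i \<subseteq> E"
    and N: "\<And>w S. finite S \<Longrightarrow> S \<subseteq> E \<Longrightarrow> (\<And>z. z \<in> S \<Longrightarrow> f z = w) \<Longrightarrow> card S \<le> N"
    and B: "f ` E \<subseteq> B"
  shows "(\<Sum>i. indicator (f ` D i) w :: ennreal) \<le> of_nat N * indicator B w"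
proof (rule suminf_le_const)
  fix n
  define I where "I = {i. i < n \<and> w \<in> f ` D i}"
  have "\<forall>i\<in>I. \<exists>z. z \<in> D i \<and> f z = w" by (auto simp: I_def)
  then obtain p where p: "\<And>i. i \<in> I \<Longrightarrow> p i \<in> D i \<and> f (p i) = w" by metis
  have "inj_on p I"
    using p disj unfolding inj_on_def disjoint_family_on_def by (metis IntI UNIV_I empty_iff)
  have "finite I" by (simp add: I_def)
  then have "card I \<le> N"
    using p DE N[of "p ` I" w] card_image[OF \<open>inj_on p I\<close>] by fastforce
  have "(\<Sum>i<n. indicator (f ` D i) w :: ennreal) = of_nat (card I)"
  proof -
    have "(\<Sum>i<n. indicator (f ` D i) w :: ennreal) = (\<Sum>i\<in>{..<n}. if i \<in> I then 1 else 0)"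
      by (intro sum.cong) (auto simp: I_def indicator_def)
    also have "\<dots> = (\<Sum>i\<in>I. 1)"
      by (subst sum.inter_restrict[symmetric], simp, rule sum.cong) (auto simp: I_def)
    finally show ?thesis by simp
  qed
  also have "\<dots> \<le> of_nat N * indicator B w"
  proof (cases "I = {}")
    case False
    then have "w \<in> B" using B DE by (fastforce simp: I_def)
    then show ?thesis using \<open>card I \<le> N\<close> by simp
  qed simp
  finally show "(\<Sum>i<n. indicator (f ` D i) w :: ennreal) \<le> of_nat N * indicator B w" .
qed simp

text \<open>
  The global form of the expansion estimate: \<open>E\<close> is cut into countably many disjoint pieces (by
  Lindelof's theorem) on which the local estimate holds. The images of the pieces lie in \<open>B\<close> and
  cover each point at most \<open>N\<close> times, so \<open>f\<close>-preimages shrink by the factor \<open>N / \<kappa>\<^sup>2\<close>.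
\<close>
lemma log_measure_preimage_le:
  assumes f: "f holomorphic_on S" and S: "open S"
    and E: "E \<in> sets borel" "E \<subseteq> S"
    and nz: "\<And>z. z \<in> E \<Longrightarrow> z \<noteq> 0 \<and> f z \<noteq> 0 \<and> deriv f z \<noteq> 0"
    and \<kappa>: "0 \<le> \<kappa>" "\<And>z. z \<in> E \<Longrightarrow> \<kappa> \<le> cmod (z * deriv f z / f z)"
    and N: "\<And>w T. finite T \<Longrightarrow> T \<subseteq> E \<Longrightarrow> (\<And>z. z \<in> T \<Longrightarrow> f z = w) \<Longrightarrow> card T \<le> N"
    and B: "B \<in> sets borel" "f ` E \<subseteq> B"
  shows "ennreal (\<kappa>\<^sup>2) * emeasure log_measure E \<le> 4096 * (of_nat N * emeasure log_measure B)"
proof (cases "E = {}")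
  case False
  let ?P = "\<lambda>z r. r > 0 \<and> (\<forall>E. E \<in> sets borel \<longrightarrow> E \<subseteq> ball z r \<longrightarrow>
       f ` E \<in> sets borel \<and>
       ((\<forall>z\<in>E. \<kappa> \<le> cmod (z * deriv f z / f z)) \<longrightarrow>
         ennreal (\<kappa>\<^sup>2) * emeasure log_measure E \<le> 4096 * emeasure log_measure (f ` E)))"
  have "\<exists>r. ?P z r" if "z \<in> E" for z
  proof -
    have "z \<in> S" using that E by auto
    from nz[OF that] have "z \<noteq> 0" "f z \<noteq> 0" "deriv f z \<noteq> 0" by auto
    from log_measure_image_local[OF f S \<open>z \<in> S\<close> this] obtain r where "r > 0"
      and r: "\<And>E. E \<in> sets borel \<Longrightarrow> E \<subseteq> ball z r \<Longrightarrow> f ` E \<in> sets borel"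
        "\<And>E \<kappa>. \<lbrakk>E \<in> sets borel; E \<subseteq> ball z r; 0 \<le> \<kappa>;
          \<And>z. z \<in> E \<Longrightarrow> \<kappa> \<le> cmod (z * deriv f z / f z)\<rbrakk>
          \<Longrightarrow> ennreal (\<kappa>\<^sup>2) * emeasure log_measure E \<le> 4096 * emeasure log_measure (f ` E)"
      by metis
    show ?thesis
      by (rule exI[of _ r], intro conjI allI impI \<open>r > 0\<close> r \<kappa>(1)) auto
  qed
  then obtain r where r: "\<And>z. z \<in> E \<Longrightarrow> ?P z (r z)" by metis
  obtain F' where F': "F' \<subseteq> (\<lambda>z. ball z (r z)) ` E" "countable F'"
      "\<Union>F' = \<Union>((\<lambda>z. ball z (r z)) ` E)"
    by (rule Lindelof[of "(\<lambda>z. ball z (r z)) ` E"]) auto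
  have cov: "E \<subseteq> \<Union>F'"
    unfolding F'(3) using r by force
  then have "F' \<noteq> {}" using False by auto
  define D where "D i = E \<inter> disjointed (from_nat_into F') i" for i
  have ran: "range (from_nat_into F') = F'"
    using F'(2) \<open>F' \<noteq> {}\<close> by (rule range_from_nat_into[rotated])
  have UD: "(\<Union>i. D i) = E"
    unfolding D_def using cov ran by (simp add: UN_disjointed_eq flip: Int_UN_distrib) auto
  have disj: "disjoint_family D"
    using disjoint_family_disjointed[of "from_nat_into F'"]
    unfolding D_def disjoint_family_on_def by blast
  have "from_nat_into F' i \<in> sets borel" for i
    using F'(1) from_nat_into[OF \<open>F' \<noteq> {}\<close>, of i] by auto
  then have mD: "D i \<in> sets borel" for i
    unfolding D_def disjointed_def using E(1) by (intro sets.Int sets.Diff sets.finite_UN) auto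
  have DE: "D i \<subseteq> E" for i by (auto simp: D_def)
  have loc: "f ` D i \<in> sets borel"
      "ennreal (\<kappa>\<^sup>2) * emeasure log_measure (D i) \<le> 4096 * emeasure log_measure (f ` D i)" for i
  proof -
    obtain z where z: "z \<in> E" "from_nat_into F' i = ball z (r z)"
      using F'(1) from_nat_into[OF \<open>F' \<noteq> {}\<close>, of i] by auto
    have "D i \<subseteq> ball z (r z)"
      using z(2) disjointed_subset[of "from_nat_into F'" i] by (auto simp: D_def)
    then show "f ` D i \<in> sets borel"
      "ennreal (\<kappa>\<^sup>2) * emeasure log_measure (D i) \<le> 4096 * emeasure log_measure (f ` D i)"
      using r[OF z(1)] mD[of i] \<kappa>(2) DE[of i] by blast+
  qed
  have "ennreal (\<kappa>\<^sup>2) * emeasure log_measure E = (\<Sum>i. ennreal (\<kappa>\<^sup>2) * emeasure log_measure (D i))"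
    using suminf_emeasure[of D log_measure] mD disj by (simp add: UD subset_eq image_iff)
  also have "\<dots> \<le> (\<Sum>i. 4096 * emeasure log_measure (f ` D i))"
    by (intro suminf_le loc) auto
  also have "\<dots> = 4096 * (\<Sum>i. \<integral>\<^sup>+w. indicator (f ` D i) w \<partial>log_measure)"
    using loc(1) by simp
  also have "(\<Sum>i. \<integral>\<^sup>+w. indicator (f ` D i) w \<partial>log_measure) = (\<integral>\<^sup>+w. (\<Sum>i. indicator (f ` D i) w) \<partial>log_measure)"
    using loc(1) by (intro nn_integral_suminf[symmetric]) auto
  also have "\<dots> \<le> (\<integral>\<^sup>+w. of_nat N * indicator B w \<partial>log_measure)"
    by (intro nn_integral_mono sum_indicator_images_le[OF disj DE N B(2)])
  also have "\<dots> = of_nat N * emeasure log_measure B"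
    using B(1) by (simp add: nn_integral_cmult_indicator)
  finally show ?thesis by (simp add: mult_left_mono)
qed simp

section \<open>The counting function\<close>

text \<open>
  The function \<open>max_num_pts\<close> is defined as a \<open>Max\<close>, which is only meaningful once its range is known
  to be finite. The lemmas up to \<open>num_pts_bounded\<close> establish this; afterwards the counting function
  is used only through monotonicity, unboundedness and \<open>card_le_max_num_pts\<close>.
\<close>
lemma transcendental_nonconstant:
  assumes "transcendental_entire f"
  shows "\<not> (\<lambda>z. f z - a) constant_on UNIV"
proof
  assume "(\<lambda>z. f z - a) constant_on UNIV"
  then obtain c where "\<And>z. f z - a = c" by (auto simp: constant_on_def)
  then have "f z = poly [:c + a:] z" for z by (simp add: algebra_simps)
  then show False using assms unfolding transcendental_entire_def by blast
qed

lemma finite_pts: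
  assumes "transcendental_entire f"
  shows "finite {z. cmod z \<le> r \<and> f z = a}"
proof -
  have "finite {z \<in> cball 0 r. f z - a = 0}"
    using assms transcendental_nonconstant[OF assms]
    by (intro holomorphic_compact_finite_zeros[of _ UNIV])
       (auto simp: transcendental_entire_def intro!: holomorphic_intros)
  then show ?thesis by (simp add: conj_commute)
qed

lemma zorder_pts_pos:
  assumes f: "transcendental_entire f" and "f z = a"
  shows "zorder (\<lambda>w. f w - a) z > 0"
proof -
  have "\<exists>w\<in>UNIV. f w - a \<noteq> 0"
  proof (rule ccontr)
    assume "\<not> ?thesis"
    then have "(\<lambda>z. f z - a) constant_on UNIV" by (auto simp: constant_on_def)
    then show False using transcendental_nonconstant[OF f] by blast
  qed
  moreover have "(\<lambda>w. f w - a) holomorphic_on UNIV"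
    using f by (auto simp: transcendental_entire_def intro!: holomorphic_intros)
  ultimately show ?thesis
    using zorder_exist_zero[of "\<lambda>w. f w - a" UNIV z] assms(2) connected_UNIV[where ?'a = complex] by simp
qed

lemma card_pts_le_num_pts:
  assumes "transcendental_entire f"
  shows "card {z. cmod z \<le> r \<and> f z = a} \<le> num_pts f r a"
proof -
  have "card {z. cmod z \<le> r \<and> f z = a} = (\<Sum>z | cmod z \<le> r \<and> f z = a. 1)" by simp
  also have "\<dots> \<le> num_pts f r a"
    unfolding num_pts_def using zorder_pts_pos[OF assms, of _ a] by (intro sum_mono) (simp add: Suc_le_eq)
  finally show ?thesis .
qed

lemma factor_zeros:
  assumes "finite Z" "G holomorphic_on UNIV" "\<And>w. w \<in> Z \<Longrightarrow> G w = (0::complex)"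
  shows "\<exists>h. h holomorphic_on UNIV \<and> (\<forall>z. G z = (\<Prod>w\<in>Z. z - w) * h z)"
  using assms
proof (induction Z arbitrary: G)
  case (insert a Z)
  define G1 where "G1 z = (if z = a then deriv G a else (G z - G a) / (z - a))" for z
  have G1: "G1 holomorphic_on UNIV"
    unfolding G1_def using insert.prems(1) by (intro pole_lemma_open) auto
  have eq: "G z = (z - a) * G1 z" for z
    using insert.prems(2)[of a] by (simp add: G1_def)
  have "G1 w = 0" if "w \<in> Z" for w
    using eq[of w] insert.prems(2)[of w] that insert.hyps by auto
  then obtain h where "h holomorphic_on UNIV" "\<forall>z. G1 z = (\<Prod>w\<in>Z. z - w) * h z"
    using insert.IH[OF G1] by blast
  then show ?case
    using eq insert.hyps by (auto simp: mult.assoc intro!: exI[of _ h])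
qed auto

text \<open>
  A version of Jensen's inequality for distinct zeros. Dividing \<open>G\<close> by the product of its zeros
  leaves an entire function \<open>h\<close>. On the circle of radius \<open>2 \<bar>p\<bar> + 3 r\<close> every point has distance at
  least \<open>2 (\<bar>p\<bar> + r)\<close> from each zero, while \<open>p\<close> has distance at most \<open>\<bar>p\<bar> + r\<close>. The maximum principle
  for \<open>h\<close> then gains a factor 2 for each zero.
\<close>
lemma zeros_Jensen_bound:
  assumes G: "G holomorphic_on UNIV" and r: "r > 0"
    and Z: "finite Z" "\<And>w. w \<in> Z \<Longrightarrow> G w = 0 \<and> cmod w \<le> r"
    and M: "\<And>z. cmod z = 2 * cmod p + 3 * r \<Longrightarrow> cmod (G z) \<le> M"
  shows "2 ^ card Z * cmod (G p) \<le> M"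
proof -
  obtain h where h: "h holomorphic_on UNIV" and Gh: "\<And>z. G z = (\<Prod>w\<in>Z. z - w) * h z"
    using factor_zeros[OF Z(1) G] Z(2) by metis
  define R s where "R = 2 * cmod p + 3 * r" and "s = cmod p + r"
  have s: "s > 0" "R > 0" using r by (auto simp: s_def R_def add_nonneg_pos)
  have bound: "cmod (h z) \<le> M / (2 * s) ^ card Z" if "cmod z = R" for z
  proof -
    have "(2 * s) ^ card Z = (\<Prod>w\<in>Z. 2 * s)" by simp
    also have "\<dots> \<le> (\<Prod>w\<in>Z. cmod (z - w))"
    proof (rule prod_mono)
      fix w assume "w \<in> Z"
      then have "cmod w \<le> r" using Z by auto
      then show "0 \<le> 2 * s \<and> 2 * s \<le> cmod (z - w)"
        using norm_triangle_ineq2[of z w] that s by (auto simp: R_def s_def)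
    qed
    also have "\<dots> = cmod (\<Prod>w\<in>Z. z - w)" by (simp add: prod_norm)
    finally have "(2 * s) ^ card Z * cmod (h z) \<le> cmod (G z)"
      by (simp add: Gh norm_mult mult_right_mono)
    also have "\<dots> \<le> M" using M that by (simp add: R_def)
    finally show ?thesis using s by (simp add: field_simps)
  qed
  have "cmod (h p) \<le> M / (2 * s) ^ card Z"
  proof (rule maximum_modulus_frontier[of h "cball 0 R"])
    show "h holomorphic_on interior (cball 0 R)" "continuous_on (closure (cball 0 R)) h"
      using h holomorphic_on_subset by (blast intro: holomorphic_on_imp_continuous_on)+
    show "\<And>z. z \<in> frontier (cball 0 R) \<Longrightarrow> cmod (h z) \<le> M / (2 * s) ^ card Z"
      using bound by (simp add: dist_norm)
    show "p \<in> cball 0 R" using r by (simp add: R_def)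
  qed auto
  moreover have "cmod (\<Prod>w\<in>Z. p - w) \<le> s ^ card Z"
  proof -
    have "cmod (\<Prod>w\<in>Z. p - w) = (\<Prod>w\<in>Z. cmod (p - w))" by (simp add: prod_norm)
    also have "\<dots> \<le> (\<Prod>w\<in>Z. s)"
      using Z norm_triangle_ineq4[of p] by (intro prod_mono) (force simp: s_def intro: order_trans)
    finally show ?thesis by simp
  qed
  ultimately have "cmod (G p) \<le> s ^ card Z * (M / (2 * s) ^ card Z)"
    unfolding Gh norm_mult using s by (intro mult_mono) auto
  then show ?thesis using s by (simp add: power_mult_distrib field_simps)
qed

text \<open>
  To bound the number of \<open>a\<close>-points uniformly in \<open>a\<close>, the value of \<open>f - a\<close> at some point must be
  bounded below uniformly in \<open>a\<close>. If \<open>f\<close> takes different values at \<open>p1\<close> and \<open>p2\<close>, one of these two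
  points always serves.
\<close>
lemma card_pts_bounded:
  assumes f: "transcendental_entire f" and r: "r > 0"
  shows "\<exists>C. \<forall>a. card {z. cmod z \<le> r \<and> f z = a} \<le> C"
proof -
  have holf: "f holomorphic_on UNIV" using f by (simp add: transcendental_entire_def)
  obtain p1 p2 where p: "f p1 \<noteq> f p2"
    using transcendental_nonconstant[OF f, of 0] unfolding constant_on_def by auto metis
  define R where "R = 2 * (cmod p1 + cmod p2) + 3 * r"
  have "compact (f ` cball 0 R)"
    by (intro compact_continuous_image holomorphic_on_imp_continuous_on)
       (auto intro: holomorphic_on_subset[OF holf])
  then obtain M where M: "\<And>z. cmod z \<le> R \<Longrightarrow> cmod (f z) \<le> M"
    using compact_imp_bounded bounded_iff by (metis imageI mem_cball_0)
  define d where "d = cmod (f p1 - f p2)"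
  have d: "d > 0" using p by (simp add: d_def)
  define C where "C = nat \<lceil>4 * M / d\<rceil>"
  have "card {z. cmod z \<le> r \<and> f z = a} \<le> C" for a
  proof (cases "{z. cmod z \<le> r \<and> f z = a} = {}")
    case False
    define Z where "Z = {z. cmod z \<le> r \<and> f z = a}"
    have fin: "finite Z" unfolding Z_def by (rule finite_pts[OF f])
    have rR: "r \<le> R" using r by (simp add: R_def)
    have aM: "cmod a \<le> M" using False M rR by force
    have "d \<le> cmod (f p1 - a) + cmod (f p2 - a)"
      unfolding d_def using norm_triangle_ineq4[of "f p1 - a" "f p2 - a"] by simp
    then obtain p where p: "p \<in> {p1, p2}" and pd: "d / 2 \<le> cmod (f p - a)"
      by (metis (full_types) add_mono_thms_linordered_field(5) field_sum_of_halves insertCI not_less)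
    have "2 ^ card Z * cmod (f p - a) \<le> 2 * M"
    proof (rule zeros_Jensen_bound[where G = "\<lambda>z. f z - a", OF _ r fin])
      show "(\<lambda>z. f z - a) holomorphic_on UNIV" by (intro holomorphic_intros holf)
      fix z assume "cmod z = 2 * cmod p + 3 * r"
      then have "cmod z \<le> R" using p by (auto simp: R_def)
      then show "cmod (f z - a) \<le> 2 * M"
        using M[of z] aM norm_triangle_ineq4[of "f z" a] by linarith
    qed (auto simp: Z_def)
    moreover have "2 ^ card Z * (d / 2) \<le> 2 ^ card Z * cmod (f p - a)"
      using pd by (intro mult_left_mono) auto
    ultimately have "2 ^ card Z * (d / 2) \<le> 2 * M" by linarith
    then have "2 ^ card Z \<le> 4 * M / d" using d by (simp add: field_simps)
    moreover have "real (card Z) < 2 ^ card Z" by (rule of_nat_less_two_power)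
    ultimately have "real (card Z) \<le> 4 * M / d" by linarith
    then show ?thesis unfolding C_def Z_def by linarith
  next
    case True
    then show ?thesis by (metis card.empty le0)
  qed
  then show ?thesis by blast
qed

lemma zorder_simple_pt:
  assumes f: "f holomorphic_on UNIV" and "deriv f z \<noteq> 0"
  shows "zorder (\<lambda>w. f w - f z) z = 1"
proof (rule zorder_zero_eqI[of _ UNIV])
  have d: "deriv (\<lambda>w. f w - f z) z = deriv f z"
    using f by (intro DERIV_imp_deriv)
      (auto intro!: derivative_eq_intros holomorphic_derivI[of _ UNIV])
  show "(deriv ^^ nat 1) (\<lambda>w. f w - f z) z \<noteq> 0" using d assms(2) by simp
qed (use f in \<open>auto intro!: holomorphic_intros\<close>)

text \<open>
  Multiplicities larger than 1 occur only at the finitely many zeros of \<open>f'\<close> in the disk. Their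
  total contribution is at most a sum over those zeros that does not involve \<open>a\<close>.
\<close>
lemma num_pts_bounded:
  assumes f: "transcendental_entire f"
  shows "\<exists>C. \<forall>a. num_pts f r a \<le> C"
proof -
  have holf: "f holomorphic_on UNIV" using f by (simp add: transcendental_entire_def)
  define K where "K = {z. cmod z \<le> r \<and> deriv f z = 0}"
  have finK: "finite K"
  proof -
    have "\<not> deriv f constant_on UNIV"
    proof
      assume "deriv f constant_on UNIV"
      then obtain c where c: "\<And>z. deriv f z = c" by (auto simp: constant_on_def)
      have "((\<lambda>z. f z - c * z) has_field_derivative 0) (at z)" for z
        using holomorphic_derivI[OF holf open_UNIV UNIV_I, of z] c[of z]
        by (auto intro!: derivative_eq_intros)
      then have "\<exists>b. \<forall>z\<in>UNIV. f z - c * z = b"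
        by (intro has_field_derivative_zero_constant) (auto intro: has_field_derivative_at_within)
      then obtain b where "\<And>z. f z - c * z = b" by blast
      then have "f z = poly [:b, c:] z" for z by (simp add: algebra_simps)
      then show False using f unfolding transcendental_entire_def by blast
    qed
    then have "finite {z \<in> cball 0 r. deriv f z = 0}"
      using holomorphic_deriv[OF holf]
      by (intro holomorphic_compact_finite_zeros[of _ UNIV]) auto
    then show ?thesis by (simp add: K_def)
  qed
  obtain C where C: "\<And>a. card {z. cmod z \<le> \<bar>r\<bar> + 1 \<and> f z = a} \<le> C"
    using card_pts_bounded[OF f, of "\<bar>r\<bar> + 1"] by (metis abs_ge_zero add_nonneg_pos zero_less_one)
  have "num_pts f r a \<le> C + (\<Sum>z\<in>K. nat (zorder (\<lambda>w. f w - f z) z))" for a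
  proof -
    define Z where "Z = {z. cmod z \<le> r \<and> f z = a}"
    have fin: "finite Z" unfolding Z_def by (rule finite_pts[OF f])
    have "num_pts f r a = (\<Sum>z\<in>Z. nat (zorder (\<lambda>w. f w - f z) z))"
      unfolding num_pts_def Z_def by (rule sum.cong) simp_all
    also have "\<dots> = (\<Sum>z\<in>Z - K. nat (zorder (\<lambda>w. f w - f z) z)) + (\<Sum>z\<in>Z \<inter> K. nat (zorder (\<lambda>w. f w - f z) z))"
      by (subst sum.Int_Diff[OF fin, of _ K]) (rule add.commute)
    also have "(\<Sum>z\<in>Z - K. nat (zorder (\<lambda>w. f w - f z) z)) = card (Z - K)"
      by (subst sum.cong[OF refl, of _ _ "\<lambda>_. 1"])
         (auto simp: Z_def K_def zorder_simple_pt[OF holf])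
    also have "card (Z - K) \<le> card {z. cmod z \<le> \<bar>r\<bar> + 1 \<and> f z = a}"
      by (intro card_mono finite_pts[OF f]) (auto simp: Z_def)
    also have "\<dots> \<le> C" by (rule C)
    also have "(\<Sum>z\<in>Z \<inter> K. nat (zorder (\<lambda>w. f w - f z) z)) \<le> (\<Sum>z\<in>K. nat (zorder (\<lambda>w. f w - f z) z))"
      using finK by (intro sum_mono2) auto
    finally show ?thesis by simp
  qed
  then show ?thesis by blast
qed

lemma num_pts_le_max:
  assumes "transcendental_entire f"
  shows "num_pts f r a \<le> max_num_pts f r"
proof -
  obtain C where "\<And>a. num_pts f r a \<le> C" using num_pts_bounded[OF assms] by blast
  then have "range (num_pts f r) \<subseteq> {..C}" by auto
  then have "finite (range (num_pts f r))" by (rule finite_subset) simp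
  then show ?thesis unfolding max_num_pts_def by simp
qed

lemma max_num_pts_mono:
  assumes f: "transcendental_entire f"
  shows "mono (max_num_pts f)"
proof (rule monoI)
  fix r s :: real assume "r \<le> s"
  obtain C where "\<And>a. num_pts f r a \<le> C" using num_pts_bounded[OF f] by blast
  then have "range (num_pts f r) \<subseteq> {..C}" by auto
  then have fin: "finite (range (num_pts f r))" by (rule finite_subset) simp
  show "max_num_pts f r \<le> max_num_pts f s"
    unfolding max_num_pts_def[of f r]
  proof (rule Max.boundedI[OF fin])
    fix n assume "n \<in> range (num_pts f r)"
    then obtain a where "n = num_pts f r a" by auto
    also have "\<dots> \<le> num_pts f s a"
      unfolding num_pts_def using \<open>r \<le> s\<close> by (intro sum_mono2 finite_pts[OF f]) auto
    also have "\<dots> \<le> max_num_pts f s" by (rule num_pts_le_max[OF f])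
    finally show "n \<le> max_num_pts f s" .
  qed auto
qed

text \<open>
  The witness is a point of \<open>T\<close> of largest modulus: the closed disk through it contains all of \<open>T\<close>.
  Naming a point of \<open>T\<close> keeps the bound usable when only the values of the counting function along
  \<open>T\<close> are known.
\<close>
lemma card_le_max_num_pts:
  assumes f: "transcendental_entire f" and T: "finite T" "T \<noteq> {}" "\<And>z. z \<in> T \<Longrightarrow> f z = w"
  shows "\<exists>z\<in>T. card T \<le> max_num_pts f (cmod z)"
proof -
  have "Max (cmod ` T) \<in> cmod ` T" using T by (intro Max_in) auto
  then obtain z where z: "z \<in> T" "cmod z = Max (cmod ` T)" by auto
  have "card T \<le> card {x. cmod x \<le> cmod z \<and> f x = w}"
    using T z by (intro card_mono finite_pts[OF f]) auto
  also have "\<dots> \<le> num_pts f (cmod z) w" by (rule card_pts_le_num_pts[OF f])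
  also have "\<dots> \<le> max_num_pts f (cmod z)" by (rule num_pts_le_max[OF f])
  finally show ?thesis using z by blast
qed

text \<open>
  At infinity \<open>f\<close> has an essential singularity: a finite limit there makes \<open>f\<close> constant, and an
  infinite one makes it a polynomial. Great Picard then gives infinite fibres.
\<close>
lemma transcendental_infinite_fibre:
  assumes f: "transcendental_entire f"
  shows "\<exists>w. infinite {z. f z = w}"
proof -
  have holf: "f holomorphic_on UNIV" using f by (simp add: transcendental_entire_def)
  have g: "(f \<circ> inverse) holomorphic_on (UNIV - {0})"
    by (intro holomorphic_on_compose holomorphic_intros holomorphic_on_subset[OF holf]) auto
  have no1: "\<not> ((f \<circ> inverse) \<longlongrightarrow> l) (at 0)" for l
  proof
    assume "((f \<circ> inverse) \<longlongrightarrow> l) (at 0)"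
    then have "(f \<longlongrightarrow> l) at_infinity" by (simp add: lim_at_infinity_0)
    then have "f z - 0 = l" for z using Liouville_weak[OF holf] by simp
    then show False using transcendental_nonconstant[OF f, of 0] by (auto simp: constant_on_def)
  qed
  have no2: "\<not> ((inverse \<circ> (f \<circ> inverse)) \<longlongrightarrow> l) (at 0)" for l
  proof
    assume "((inverse \<circ> (f \<circ> inverse)) \<longlongrightarrow> l) (at 0)"
    then have "((inverse \<circ> f) \<longlongrightarrow> l) at_infinity" by (simp add: lim_at_infinity_0 o_assoc)
    then obtain a n where "\<And>z. f z = (\<Sum>i\<le>n. a i * z ^ i)"
      using pole_at_infinity[OF holf] by metis
    then have "f z = poly (\<Sum>i\<le>n. monom (a i) i) z" for z
      by (simp add: poly_sum poly_monom)
    then show False using f unfolding transcendental_entire_def by blast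
  qed
  obtain b where b: "\<And>w. w \<noteq> b \<Longrightarrow> infinite {x. x \<in> UNIV - {0} \<and> (f \<circ> inverse) x = w}"
    using great_Picard_infinite[OF open_UNIV UNIV_I g no1 no2] by metis
  have "infinite {x. x \<in> UNIV - {0} \<and> (f \<circ> inverse) x = b + 1}" by (rule b) simp
  then have "infinite (inverse ` {x. x \<in> UNIV - {0} \<and> (f \<circ> inverse) x = b + 1})"
    by (subst finite_image_iff) (auto simp: inj_on_def)
  then have "infinite {z. f z = b + 1}"
    by (rule contrapos_nn) (auto elim!: finite_subset[rotated])
  then show ?thesis by blast
qed

lemma max_num_pts_unbounded:
  assumes f: "transcendental_entire f"
  shows "\<exists>r. N \<le> max_num_pts f r"
proof -
  obtain w where "infinite {z. f z = w}" using transcendental_infinite_fibre[OF f] by blast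
  then obtain T where T: "T \<subseteq> {z. f z = w}" "finite T" "card T = Suc N"
    by (metis infinite_arbitrarily_large)
  then have "T \<noteq> {}" by auto
  then obtain z where "card T \<le> max_num_pts f (cmod z)"
    using card_le_max_num_pts[OF f T(2), of w] T(1) by auto
  then show ?thesis using T(3) by (intro exI[of _ "cmod z"]) simp
qed

section \<open>Orbits that avoid the exceptional set\<close>
definition exceptional_set :: "(complex \<Rightarrow> complex) \<Rightarrow> real \<Rightarrow> complex set" where
  "exceptional_set f \<epsilon> = {z \<in> Delta.
     cmod (z * deriv f z / f z) < real (max_num_pts f (cmod z)) powr (1 / 2 + \<epsilon>) \<or>
     cmod (f z) < (1 + \<epsilon>) * cmod z}"

lemma borel_measurable_max_num_pts:
  assumes "transcendental_entire f"
  shows "(\<lambda>z::complex. real (max_num_pts f (cmod z))) \<in> borel_measurable borel"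
proof -
  have "mono (\<lambda>r. real (max_num_pts f r))"
    using max_num_pts_mono[OF assms] by (simp add: mono_def)
  then have [measurable]: "(\<lambda>r. real (max_num_pts f r)) \<in> borel_measurable borel"
    by (rule borel_measurable_mono)
  show ?thesis by measurable
qed

lemma exceptional_set_borel:
  assumes f: "transcendental_entire f"
  shows "exceptional_set f \<epsilon> \<in> sets borel"
proof -
  have hol: "f holomorphic_on UNIV" using f by (simp add: transcendental_entire_def)
  have [measurable]: "f \<in> borel_measurable borel" "deriv f \<in> borel_measurable borel"
    using hol holomorphic_deriv[OF hol open_UNIV]
    by (auto intro!: borel_measurable_continuous_onI holomorphic_on_imp_continuous_on)
  note [measurable] = borel_measurable_max_num_pts[OF f]
  show ?thesis unfolding exceptional_set_def Delta_def by measurable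
qed

text \<open>
  On a layer where the counting function is between \<open>2^k\<close> and \<open>2^(k+1)\<close>, a value is taken at most
  \<open>2^(k+1)\<close> times while logarithmic area is expanded by at least \<open>(2^k) powr (1 + 2 \<epsilon>)\<close>. The
  exponent exceeds 1, so the quotient decays geometrically in \<open>k\<close>. Layers defined through the counting
  function rather than through \<open>\<bar>z\<bar>\<close> avoid any comparison of the counting function at different radii.
\<close>
lemma layer_preimage_le:
  assumes f: "transcendental_entire f" and \<epsilon>: "\<epsilon> > 0"
    and B: "B \<in> sets borel" and E: "E \<in> sets borel" "E \<subseteq> Delta - exceptional_set f \<epsilon>" "f ` E \<subseteq> B"
    and layer: "\<And>z. z \<in> E \<Longrightarrow> 2 ^ k \<le> max_num_pts f (cmod z) \<and> max_num_pts f (cmod z) < 2 ^ Suc k"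
  shows "emeasure log_measure E \<le> ennreal (8192 * (2 powr (- 2 * \<epsilon>)) ^ k) * emeasure log_measure B"
proof -
  have hol: "f holomorphic_on UNIV" using f by (simp add: transcendental_entire_def)
  define t \<kappa> where "t = (2::real) ^ k" and "\<kappa> = t powr (1 / 2 + \<epsilon>)"
  have t: "t > 0" by (simp add: t_def)
  then have \<kappa>: "\<kappa> > 0" by (simp add: \<kappa>_def)
  have good: "\<kappa> \<le> cmod (z * deriv f z / f z)" "(1 + \<epsilon>) * cmod z \<le> cmod (f z)" "1 \<le> cmod z" if "z \<in> E" for z
  proof -
    have z: "z \<in> Delta" "z \<notin> exceptional_set f \<epsilon>" using that E(2) by auto
    have "real (2 ^ k) \<le> real (max_num_pts f (cmod z))"
      using layer[OF that] by (simp only: of_nat_le_iff)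
    then have "\<kappa> \<le> real (max_num_pts f (cmod z)) powr (1 / 2 + \<epsilon>)"
      unfolding \<kappa>_def t_def using \<epsilon> by (intro powr_mono2) auto
    also have "\<dots> \<le> cmod (z * deriv f z / f z)"
      using z by (auto simp: exceptional_set_def not_less)
    finally show "\<kappa> \<le> cmod (z * deriv f z / f z)" .
    show "(1 + \<epsilon>) * cmod z \<le> cmod (f z)" "1 \<le> cmod z"
      using z by (auto simp: exceptional_set_def not_less Delta_def)
  qed
  have nz: "z \<noteq> 0 \<and> f z \<noteq> 0 \<and> deriv f z \<noteq> 0" if "z \<in> E" for z
    using good(1)[OF that] good(3)[OF that] \<kappa> by auto
  have card: "card T \<le> 2 ^ Suc k"
    if T: "finite T" "T \<subseteq> E" "\<And>z. z \<in> T \<Longrightarrow> f z = w" for w T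
  proof (cases "T = {}")
    case False
    then obtain z where "z \<in> T" "card T \<le> max_num_pts f (cmod z)"
      using card_le_max_num_pts[OF f T(1) _ T(3)] by blast
    then show ?thesis using layer[of z] T(2) by auto
  qed simp
  have main: "ennreal (\<kappa>\<^sup>2) * emeasure log_measure E \<le> 4096 * (of_nat (2 ^ Suc k) * emeasure log_measure B)"
    by (rule log_measure_preimage_le[OF hol open_UNIV E(1) _ nz _ good(1) card B E(3)])
       (use \<kappa> in auto)
  have c: "1 / \<kappa>\<^sup>2 * (4096 * (2 * t)) = 8192 * (2 powr (- 2 * \<epsilon>)) ^ k"
  proof -
    have "\<kappa>\<^sup>2 = t powr (1 + 2 * \<epsilon>)"
      unfolding \<kappa>_def by (simp add: power2_eq_square flip: powr_add)
    also have "\<dots> = t * t powr (2 * \<epsilon>)" using t by (simp add: powr_add)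
    finally have k2: "\<kappa>\<^sup>2 = t * t powr (2 * \<epsilon>)" .
    have "t powr (2 * \<epsilon>) = 2 powr (real k * (2 * \<epsilon>))"
      by (simp add: t_def powr_powr flip: powr_realpow)
    moreover have "(2 powr (- 2 * \<epsilon>)) ^ k = 2 powr (- (real k * (2 * \<epsilon>)))"
      by (simp add: powr_powr mult_ac flip: powr_realpow)
    ultimately show ?thesis using t unfolding k2 by (simp add: powr_minus field_simps)
  qed
  have "emeasure log_measure E = ennreal (1 / \<kappa>\<^sup>2 * \<kappa>\<^sup>2) * emeasure log_measure E"
    using \<kappa> by simp
  also have "\<dots> = ennreal (1 / \<kappa>\<^sup>2) * (ennreal (\<kappa>\<^sup>2) * emeasure log_measure E)"
    by (subst ennreal_mult) (auto simp: mult.assoc)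
  also have "\<dots> \<le> ennreal (1 / \<kappa>\<^sup>2) * (4096 * (of_nat (2 ^ Suc k) * emeasure log_measure B))"
    by (intro mult_left_mono main) simp
  also have "4096 * (of_nat (2 ^ Suc k) * emeasure log_measure B) = ennreal (4096 * (2 * t)) * emeasure log_measure B"
  proof -
    have "of_nat (2 ^ Suc k) = ennreal (2 * t)"
      by (simp add: t_def ennreal_of_nat_eq_real_of_nat del: of_nat_power)
    moreover have "(4096::ennreal) = ennreal 4096" by simp
    ultimately show ?thesis using t by (simp only: ennreal_mult' mult.assoc)
  qed
  also have "ennreal (1 / \<kappa>\<^sup>2) * (ennreal (4096 * (2 * t)) * emeasure log_measure B)
      = ennreal (1 / \<kappa>\<^sup>2 * (4096 * (2 * t))) * emeasure log_measure B"
    using t by (subst ennreal_mult) (auto simp: mult.assoc)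
  finally show ?thesis unfolding c .
qed

text \<open>
  Summing the geometric bounds over all layers beyond a large \<open>K\<close> gives a factor as small as desired.
  The further requirement that the counting function be at least 4 is for the expansion of
  derivatives in \<open>good_orbits_expand\<close>.
\<close>
lemma preimage_contraction:
  assumes f: "transcendental_entire f" and \<epsilon>: "\<epsilon> > 0"
  shows "\<exists>R\<ge>1. 4 \<le> max_num_pts f R \<and> (\<forall>B\<in>sets borel.
       emeasure log_measure {z. R \<le> cmod z \<and> z \<notin> exceptional_set f \<epsilon> \<and> f z \<in> B}
         \<le> ennreal (1 / 2) * emeasure log_measure B)"
proof -
  have hol: "f holomorphic_on UNIV" using f by (simp add: transcendental_entire_def)
  define q where "q = (2::real) powr (- 2 * \<epsilon>)"
  have q: "0 < q" "q < 1" using \<epsilon> by (auto simp: q_def intro!: powr_less_one)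
  have "(\<lambda>K. 8192 * q ^ K / (1 - q)) \<longlonglongrightarrow> 8192 * 0 / (1 - q)"
    using q by (intro tendsto_intros LIMSEQ_realpow_zero) auto
  then have "\<forall>\<^sub>F K in sequentially. 8192 * q ^ K / (1 - q) < 1 / 2"
    by (rule order_tendstoD) simp
  moreover have "\<forall>\<^sub>F K::nat in sequentially. 2 \<le> K" by (rule eventually_ge_at_top)
  ultimately have "\<forall>\<^sub>F K in sequentially. 8192 * q ^ K / (1 - q) < 1 / 2 \<and> 2 \<le> K"
    by (rule eventually_conj)
  then obtain K where K: "8192 * q ^ K / (1 - q) < 1 / 2" "2 \<le> K"
    using eventually_happens'[OF sequentially_bot] by blast
  obtain R0 where R0: "2 ^ K \<le> max_num_pts f R0" using max_num_pts_unbounded[OF f] by blast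
  define R where "R = max 1 R0"
  have nR: "2 ^ K \<le> max_num_pts f (cmod z)" if "R \<le> cmod z" for z
    using order_trans[OF R0 monoD[OF max_num_pts_mono[OF f], of R0 "cmod z"]] that by (simp add: R_def)
  have R: "R \<ge> 1" by (simp add: R_def)
  have "(4::nat) = 2 ^ 2" by simp
  also have "\<dots> \<le> 2 ^ K" using K(2) by (intro power_increasing) auto
  also have "\<dots> \<le> max_num_pts f R" using nR[of "of_real R"] R by simp
  finally have n4: "4 \<le> max_num_pts f R" .
  show ?thesis
  proof (intro exI[of _ R] conjI R n4 ballI)
    fix B :: "complex set" assume B: "B \<in> sets borel"
    define E where "E = {z. R \<le> cmod z \<and> z \<notin> exceptional_set f \<epsilon> \<and> f z \<in> B}"
    define L where "L k = {z. 2 ^ (K + k) \<le> max_num_pts f (cmod z) \<and> max_num_pts f (cmod z) < 2 ^ Suc (K + k)}" for k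
    have [measurable]: "f \<in> borel_measurable borel"
      using hol by (intro borel_measurable_continuous_onI holomorphic_on_imp_continuous_on)
    have mE: "E \<in> sets borel"
      using B exceptional_set_borel[OF f, of \<epsilon>] unfolding E_def by measurable
    have mL: "L k \<in> sets borel" for k
    proof -
      have "L k = {z. 2 ^ (K + k) \<le> real (max_num_pts f (cmod z)) \<and> real (max_num_pts f (cmod z)) < 2 ^ Suc (K + k)}"
        by (simp add: L_def del: power_Suc)
      moreover have "\<dots> \<in> sets borel"
        using borel_measurable_max_num_pts[OF f] by measurable
      ultimately show ?thesis by simp
    qed
    have cover: "E \<subseteq> (\<Union>k. E \<inter> L k)"
    proof
      fix z assume "z \<in> E"
      then have ge: "2 ^ K \<le> max_num_pts f (cmod z)" using nR by (simp add: E_def)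
      then have "1 \<le> max_num_pts f (cmod z)" by (rule order_trans[rotated]) simp
      then obtain n where n: "2 ^ n \<le> max_num_pts f (cmod z)" "max_num_pts f (cmod z) < 2 ^ (n + 1)"
        using ex_power_ivl1[of 2] by blast
      then have "(2::nat) ^ K < 2 ^ (n + 1)" using ge by linarith
      then have "K \<le> n" by (simp add: power_strict_increasing_iff del: power_Suc)
      then have "z \<in> L (n - K)" using n by (simp add: L_def)
      then show "z \<in> (\<Union>k. E \<inter> L k)" using \<open>z \<in> E\<close> by blast
    qed
    have "emeasure log_measure E \<le> emeasure log_measure (\<Union>k. E \<inter> L k)"
      using mE mL cover by (intro emeasure_mono) auto
    also have "\<dots> \<le> (\<Sum>k. emeasure log_measure (E \<inter> L k))"
      using mE mL by (intro emeasure_subadditive_countably) auto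
    also have "\<dots> \<le> (\<Sum>k. ennreal (8192 * q ^ (K + k)) * emeasure log_measure B)"
    proof (intro suminf_le)
      fix k
      show "emeasure log_measure (E \<inter> L k) \<le> ennreal (8192 * q ^ (K + k)) * emeasure log_measure B"
        unfolding q_def
        by (rule layer_preimage_le[OF f \<epsilon> B])
           (use mE mL R in \<open>auto simp: E_def L_def Delta_def\<close>)
    qed auto
    also have "\<dots> = (\<Sum>k. ennreal (8192 * q ^ (K + k))) * emeasure log_measure B"
      by simp
    also have "(\<Sum>k. ennreal (8192 * q ^ (K + k))) = ennreal (8192 * q ^ K / (1 - q))"
    proof (rule suminf_ennreal_eq)
      have "(\<lambda>k. 8192 * q ^ K * q ^ k) sums (8192 * q ^ K * (1 / (1 - q)))"
        using q by (intro sums_mult geometric_sums) simp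
      then show "(\<lambda>k. 8192 * q ^ (K + k)) sums (8192 * q ^ K / (1 - q))"
        by (simp add: power_add mult.assoc)
    qed (use q in simp)
    also have "\<dots> * emeasure log_measure B \<le> ennreal (1 / 2) * emeasure log_measure B"
      using K(1) by (intro mult_right_mono ennreal_leI) auto
    finally show "emeasure log_measure {z. R \<le> cmod z \<and> z \<notin> exceptional_set f \<epsilon> \<and> f z \<in> B}
         \<le> ennreal (1 / 2) * emeasure log_measure B"
      by (simp add: E_def)
  qed
qed

definition good_orbits :: "(complex \<Rightarrow> complex) \<Rightarrow> real \<Rightarrow> real \<Rightarrow> complex set" where
  "good_orbits f \<epsilon> R = {z. \<forall>j. R \<le> cmod ((f ^^ j) z) \<and> (f ^^ j) z \<notin> exceptional_set f \<epsilon>}"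

text \<open>
  The points whose orbit stays outside the disk of radius \<open>R\<close> up to time \<open>j\<close> and enters the
  exceptional set for the first time at time \<open>j\<close>. The recursion
  presents each of these sets as a preimage of the previous one, to which the contraction applies.
\<close>
primrec first_exceptional :: "(complex \<Rightarrow> complex) \<Rightarrow> real \<Rightarrow> real \<Rightarrow> nat \<Rightarrow> complex set" where
  "first_exceptional f \<epsilon> R 0 = {z. R \<le> cmod z \<and> z \<in> exceptional_set f \<epsilon>}"
| "first_exceptional f \<epsilon> R (Suc j) = {z. R \<le> cmod z \<and> z \<notin> exceptional_set f \<epsilon> \<and> f z \<in> first_exceptional f \<epsilon> R j}"

lemma not_exceptional_growth:
  assumes "1 \<le> cmod z" "z \<notin> exceptional_set f \<epsilon>"
  shows "(1 + \<epsilon>) * cmod z \<le> cmod (f z)"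
proof -
  have "\<not> cmod (f z) < (1 + \<epsilon>) * cmod z"
    using assms unfolding exceptional_set_def Delta_def by blast
  then show ?thesis by (simp only: not_less)
qed

lemma not_good_orbit_first_exceptional:
  assumes R: "1 \<le> R" and \<epsilon>: "\<epsilon> > 0" and z: "R \<le> cmod z" "z \<notin> good_orbits f \<epsilon> R"
  shows "z \<in> (\<Union>j. first_exceptional f \<epsilon> R j)"
proof -
  have step: "R \<le> cmod (f w)" if "R \<le> cmod w" "w \<notin> exceptional_set f \<epsilon>" for w
  proof -
    have "1 * cmod w \<le> (1 + \<epsilon>) * cmod w" using \<epsilon> by (intro mult_right_mono) auto
    then show ?thesis using not_exceptional_growth[of w f \<epsilon>] that R by linarith
  qed
  have "\<exists>j. (f ^^ j) z \<in> exceptional_set f \<epsilon>"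
  proof (rule ccontr)
    assume no: "\<not> ?thesis"
    have "R \<le> cmod ((f ^^ j) z)" for j
      using z(1) step no by (induction j) auto
    then show False using no z(2) by (auto simp: good_orbits_def)
  qed
  then obtain j where j: "(f ^^ j) z \<in> exceptional_set f \<epsilon>" "\<And>i. i < j \<Longrightarrow> (f ^^ i) z \<notin> exceptional_set f \<epsilon>"
    using exists_least_iff[of "\<lambda>j. (f ^^ j) z \<in> exceptional_set f \<epsilon>"] by blast
  have "R \<le> cmod z \<Longrightarrow> (f ^^ j) z \<in> exceptional_set f \<epsilon> \<Longrightarrow> (\<And>i. i < j \<Longrightarrow> (f ^^ i) z \<notin> exceptional_set f \<epsilon>)
     \<Longrightarrow> z \<in> first_exceptional f \<epsilon> R j" for j z
  proof (induction j arbitrary: z)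
    case (Suc j)
    have z0: "z \<notin> exceptional_set f \<epsilon>" using Suc.prems(3)[of 0] by simp
    have "f z \<in> first_exceptional f \<epsilon> R j"
    proof (rule Suc.IH)
      show "R \<le> cmod (f z)" using step Suc.prems(1) z0 by simp
      show "(f ^^ j) (f z) \<in> exceptional_set f \<epsilon>" using Suc.prems(2) by (simp add: funpow_swap1)
      fix i assume "i < j"
      then show "(f ^^ i) (f z) \<notin> exceptional_set f \<epsilon>"
        using Suc.prems(3)[of "Suc i"] by (simp add: funpow_swap1)
    qed
    then show ?case using Suc.prems(1) z0 by simp
  qed simp
  then show ?thesis using z(1) j by blast
qed

text \<open>
  By the contraction, the sets of points with first entry at time \<open>j\<close> have logarithmic area at most
  \<open>(1/2)^j\<close> times that of the exceptional set, so their union has finite logarithmic area. Besides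
  this union, only the annulus between radii 1 and \<open>R\<close> is lost.
\<close>
lemma good_orbits_cofinite:
  assumes f: "transcendental_entire f" and \<epsilon>: "\<epsilon> > 0"
    and fin: "logarea (exceptional_set f \<epsilon>) < \<infinity>"
  obtains R where "1 \<le> R" "4 \<le> max_num_pts f R" "logarea (Delta - good_orbits f \<epsilon> R) < \<infinity>"
proof -
  have hol: "f holomorphic_on UNIV" using f by (simp add: transcendental_entire_def)
  have [measurable]: "f \<in> borel_measurable borel"
    using hol by (intro borel_measurable_continuous_onI holomorphic_on_imp_continuous_on)
  note [measurable] = exceptional_set_borel[OF f, of \<epsilon>]
  obtain R where R: "1 \<le> R" "4 \<le> max_num_pts f R" and half:
    "\<And>B. B \<in> sets borel \<Longrightarrow>
       emeasure log_measure {z. R \<le> cmod z \<and> z \<notin> exceptional_set f \<epsilon> \<and> f z \<in> B}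
         \<le> ennreal (1 / 2) * emeasure log_measure B"
    using preimage_contraction[OF f \<epsilon>] by blast
  let ?B = "first_exceptional f \<epsilon> R"
  have mB: "?B j \<in> sets borel" for j
    by (induction j) (auto, measurable)
  have bound: "emeasure log_measure (?B j) \<le> ennreal ((1 / 2) ^ j) * emeasure log_measure (?B 0)" for j
  proof (induction j)
    case (Suc j)
    have "emeasure log_measure (?B (Suc j)) \<le> ennreal (1 / 2) * emeasure log_measure (?B j)"
      using half[OF mB[of j]] by simp
    also have "\<dots> \<le> ennreal (1 / 2) * (ennreal ((1 / 2) ^ j) * emeasure log_measure (?B 0))"
      by (intro mult_left_mono Suc) simp
    also have "\<dots> = ennreal ((1 / 2) ^ Suc j) * emeasure log_measure (?B 0)"
      unfolding power_Suc mult.assoc[symmetric] by (subst ennreal_mult[symmetric]) auto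
    finally show ?case .
  qed simp
  have "emeasure log_measure (?B 0) \<le> emeasure log_measure (exceptional_set f \<epsilon>)"
    by (intro emeasure_mono) (auto simp: exceptional_set_borel[OF f])
  then have fin0: "emeasure log_measure (?B 0) < \<infinity>"
    using fin by (simp add: logarea_eq_emeasure[OF exceptional_set_borel[OF f]] le_less_trans)
  have "emeasure log_measure (\<Union>j. ?B j) \<le> (\<Sum>j. emeasure log_measure (?B j))"
    using mB by (intro emeasure_subadditive_countably) auto
  also have "\<dots> \<le> (\<Sum>j. ennreal ((1 / 2) ^ j) * emeasure log_measure (?B 0))"
    by (intro suminf_le bound) auto
  also have "\<dots> = (\<Sum>j. ennreal ((1 / 2) ^ j)) * emeasure log_measure (?B 0)" by simp
  also have "(\<Sum>j. ennreal ((1 / 2) ^ j)) = ennreal 2"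
    using geometric_sums[of "1 / 2 :: real"] by (intro suminf_ennreal_eq) auto
  also have "\<dots> * emeasure log_measure (?B 0) < \<infinity>"
    using fin0 by (simp add: ennreal_mult_less_top)
  finally have fU: "emeasure log_measure (\<Union>j. ?B j) < \<infinity>" .
  define A where "A = {z. 1 \<le> cmod z \<and> cmod z \<le> R}"
  have mA: "A \<in> sets borel" unfolding A_def by measurable
  have "emeasure log_measure A \<le> ennreal (1 / 1\<^sup>2) * emeasure lborel A"
    by (rule log_measure_le_lborel[OF mA]) (auto simp: A_def)
  also have "\<dots> \<le> emeasure lborel (cball (0::complex) R)"
    by (simp, intro emeasure_mono) (auto simp: A_def)
  also have "\<dots> < \<infinity>" using emeasure_lborel_cball_finite by blast
  finally have fA: "emeasure log_measure A < \<infinity>" .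
  have "Delta - good_orbits f \<epsilon> R \<subseteq> A \<union> (\<Union>j. ?B j)"
  proof
    fix z assume z: "z \<in> Delta - good_orbits f \<epsilon> R"
    show "z \<in> A \<union> (\<Union>j. ?B j)"
    proof (cases "R \<le> cmod z")
      case True
      then show ?thesis using not_good_orbit_first_exceptional[OF R(1) \<epsilon> True] z by blast
    qed (use z in \<open>auto simp: A_def Delta_def\<close>)
  qed
  then have "logarea (Delta - good_orbits f \<epsilon> R) \<le> logarea (A \<union> (\<Union>j. ?B j))"
    by (rule logarea_mono)
  also have "\<dots> = emeasure log_measure (A \<union> (\<Union>j. ?B j))"
    using mA mB by (intro logarea_eq_emeasure) auto
  also have "\<dots> \<le> emeasure log_measure A + emeasure log_measure (\<Union>j. ?B j)"
    using mA mB by (intro emeasure_subadditive) auto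
  also have "\<dots> < \<infinity>" using fA fU by simp
  finally show thesis using that R by blast
qed

text \<open>
  At points of \<open>Delta\<close> outside the exceptional set, one step of the iteration multiplies the modulus
  by at least \<open>1 + \<epsilon>\<close>.
\<close>
lemma good_orbits_escaping:
  assumes R: "1 \<le> R" and \<epsilon>: "\<epsilon> > 0"
  shows "good_orbits f \<epsilon> R \<subseteq> escaping_set f"
proof
  fix z assume z: "z \<in> good_orbits f \<epsilon> R"
  then have z': "R \<le> cmod ((f ^^ n) z)" "(f ^^ n) z \<notin> exceptional_set f \<epsilon>" for n
    by (auto simp: good_orbits_def)
  have grow: "(1 + \<epsilon>) ^ n \<le> cmod ((f ^^ n) z)" for n
  proof (induction n)
    case 0
    then show ?case using z'(1)[of 0] R by simp
  next
    case (Suc n)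
    have "(1 + \<epsilon>) * (1 + \<epsilon>) ^ n \<le> (1 + \<epsilon>) * cmod ((f ^^ n) z)"
      using \<epsilon> Suc by (intro mult_left_mono) auto
    also have "\<dots> \<le> cmod (f ((f ^^ n) z))"
      using z'(1)[of n] R by (intro not_exceptional_growth z'(2)) simp
    finally show ?case by simp
  qed
  have "filterlim (\<lambda>n. (1 + \<epsilon>) ^ n) at_top sequentially"
    using \<epsilon> by real_asymp
  then have "filterlim (\<lambda>n. cmod ((f ^^ n) z)) at_top sequentially"
    by (rule filterlim_at_top_mono) (simp add: grow)
  then show "z \<in> escaping_set f"
    by (simp add: escaping_set_def filterlim_at_infinity_conv_norm_at_top)
qed

lemma good_orbits_expand:
  assumes f: "transcendental_entire f" and R: "1 \<le> R" "4 \<le> max_num_pts f R" and \<epsilon>: "\<epsilon> > 0"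
    and z: "z \<in> good_orbits f \<epsilon> R"
  shows "2 \<le> cmod ((f ^^ j) z * deriv f ((f ^^ j) z) / f ((f ^^ j) z))"
proof -
  let ?w = "(f ^^ j) z"
  have w: "R \<le> cmod ?w" "?w \<notin> exceptional_set f \<epsilon>" using z by (auto simp: good_orbits_def)
  have "4 \<le> max_num_pts f (cmod ?w)"
    using R(2) monoD[OF max_num_pts_mono[OF f] w(1)] by linarith
  then have n: "4 \<le> real (max_num_pts f (cmod ?w))" by simp
  have "(2::real) = 4 powr (1 / 2)" by (simp add: powr_half_sqrt)
  also have "\<dots> \<le> 4 powr (1 / 2 + \<epsilon>)" using \<epsilon> by (intro powr_mono) auto
  also have "\<dots> \<le> real (max_num_pts f (cmod ?w)) powr (1 / 2 + \<epsilon>)"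
    using n \<epsilon> by (intro powr_mono2) auto
  also have "\<dots> \<le> cmod (?w * deriv f ?w / f ?w)"
    using w R(1) by (auto simp: exceptional_set_def Delta_def not_less)
  finally show ?thesis .
qed

section \<open>Sets whose complement has finite logarithmic area\<close>

text \<open>
  The squares \<open>Q k\<close> of side \<open>2^k\<close> at distance \<open>2^k\<close> from the origin are disjoint and, by scaling,
  contribute equally to the logarithmic area.
\<close>
lemma logarea_Delta: "logarea Delta = \<infinity>"
proof -
  define Q :: "nat \<Rightarrow> complex set" where "Q k = box (Complex (2 ^ k) 0) (Complex (2 ^ Suc k) (2 ^ k))" for k
  have Delta: "Delta \<in> sets borel" unfolding Delta_def by measurable
  have mQ: "Q k \<in> sets borel" for k by (simp add: Q_def)
  have disj: "disjoint_family Q"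
  proof -
    have "Q j \<inter> Q k = {}" if "j < k" for j k
    proof -
      have "(2::real) ^ Suc j \<le> 2 ^ k" using that by (intro power_increasing) auto
      then show ?thesis by (auto simp: Q_def in_box_complex_iff)
    qed
    then show ?thesis
      unfolding disjoint_family_on_def by (metis Int_commute linorder_neqE_nat)
  qed
  have low: "ennreal (1 / 9) \<le> emeasure log_measure (Q k)" for k
  proof -
    have "ennreal (4 ^ k) = emeasure lborel (Q k)"
      unfolding Q_def by (subst emeasure_lborel_box)
        (auto simp: Basis_complex_def power_mult_distrib[symmetric])
    also have "\<dots> \<le> ennreal ((3 * 2 ^ k)\<^sup>2) * emeasure log_measure (Q k)"
    proof (rule lborel_le_log_measure)
      fix z assume "z \<in> Q k"
      then have "0 < Re z" "Re z < 2 * 2 ^ k" "0 < Im z" "Im z < 2 ^ k"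
        by (auto simp: Q_def in_box_complex_iff intro: less_trans[rotated])
      then show "cmod z \<le> 3 * 2 ^ k" using cmod_le[of z] by linarith
    qed (auto simp: Q_def in_box_complex_iff)
    finally have "ennreal (1 / (9 * 4 ^ k)) * ennreal (4 ^ k) \<le>
        ennreal (1 / (9 * 4 ^ k)) * (ennreal ((3 * 2 ^ k)\<^sup>2) * emeasure log_measure (Q k))"
      by (intro mult_left_mono) auto
    also have "\<dots> = ennreal (1 / (9 * 4 ^ k) * (3 * 2 ^ k)\<^sup>2) * emeasure log_measure (Q k)"
      by (subst ennreal_mult) (auto simp: mult.assoc)
    also have "1 / (9 * 4 ^ k) * (3 * 2 ^ k)\<^sup>2 = (1::real)"
    proof -
      have "((2::real) ^ k)\<^sup>2 = 4 ^ k" by (simp add: power2_eq_square flip: power_mult_distrib)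
      then show ?thesis by (simp add: power_mult_distrib)
    qed
    finally show ?thesis by (simp flip: ennreal_mult)
  qed
  have QD: "(\<Union>k. Q k) \<subseteq> Delta"
  proof
    fix z assume "z \<in> (\<Union>k. Q k)"
    then obtain k where "2 ^ k < Re z" by (auto simp: Q_def in_box_complex_iff)
    moreover have "(1::real) \<le> 2 ^ k" by simp
    ultimately have "1 \<le> cmod z" using complex_Re_le_cmod[of z] by linarith
    then show "z \<in> Delta" by (simp add: Delta_def)
  qed
  have "(\<infinity>::ennreal) = (\<Sum>k::nat. ennreal (1 / 9))"
    by (simp add: suminf_eq_SUP ennreal_SUP_of_nat_eq_top ennreal_mult_top flip: SUP_mult_right_ennreal)
  also have "\<dots> \<le> (\<Sum>k. emeasure log_measure (Q k))" by (intro suminf_le low) auto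
  also have "\<dots> = emeasure log_measure (\<Union>k. Q k)"
    using disj mQ by (intro suminf_emeasure) auto
  also have "\<dots> \<le> emeasure log_measure Delta" using QD Delta by (intro emeasure_mono) auto
  also have "\<dots> = logarea Delta" using logarea_eq_emeasure[OF Delta] by simp
  finally show ?thesis by (simp add: top_unique)
qed

lemma area_pos_if_logarea_complement_finite:
  assumes S: "S \<in> sets borel" and fin: "logarea (Delta - S) < \<infinity>"
  shows "area S > 0"
proof (rule ccontr)
  assume "\<not> ?thesis"
  then have 0: "emeasure lborel S = 0" using S by (simp add: area_def)
  have D: "Delta \<in> sets borel" unfolding Delta_def by measurable
  have "emeasure log_measure (Delta \<inter> S) \<le> ennreal (1 / 1\<^sup>2) * emeasure lborel (Delta \<inter> S)"
    using D S by (intro log_measure_le_lborel) (auto simp: Delta_def)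
  also have "\<dots> \<le> emeasure lborel S" using S D by (simp, intro emeasure_mono) auto
  finally have "emeasure log_measure (Delta \<inter> S) = 0" using 0 by simp
  moreover have "logarea Delta \<le> emeasure log_measure (Delta - S) + emeasure log_measure (Delta \<inter> S)"
    unfolding logarea_eq_emeasure[OF D] using D S
    by (subst plus_emeasure) (auto intro!: emeasure_mono)
  ultimately show False
    using fin logarea_Delta logarea_eq_emeasure[of "Delta - S"] D S by simp
qed

lemma escaping_set_borel:
  assumes f: "f holomorphic_on UNIV"
  shows "escaping_set f \<in> sets borel"
proof -
  have [measurable]: "(f ^^ n) \<in> borel_measurable borel" for n
  proof (induction n)
    case (Suc n)
    moreover have "f \<in> borel_measurable borel"
      using f by (intro borel_measurable_continuous_onI holomorphic_on_imp_continuous_on)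
    ultimately show ?case by (simp add: measurable_comp)
  qed (simp add: id_def)
  have "escaping_set f = {z. \<forall>b::nat. \<exists>N. \<forall>n\<ge>N. real b \<le> cmod ((f ^^ n) z)}"
  proof -
    have "(\<forall>B. \<forall>\<^sub>F n in sequentially. B \<le> cmod ((f ^^ n) z)) \<longleftrightarrow>
          (\<forall>b::nat. \<forall>\<^sub>F n in sequentially. real b \<le> cmod ((f ^^ n) z))" for z
    proof (intro iffI allI)
      fix B assume *: "\<forall>b::nat. \<forall>\<^sub>F n in sequentially. real b \<le> cmod ((f ^^ n) z)"
      obtain b :: nat where "B \<le> real b" using real_arch_simple by blast
      then show "\<forall>\<^sub>F n in sequentially. B \<le> cmod ((f ^^ n) z)"
        using *[rule_format, of b] by (auto elim!: eventually_mono)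
    qed blast
    then show ?thesis
      by (simp add: escaping_set_def filterlim_at_infinity_conv_norm_at_top filterlim_at_top
          eventually_sequentially)
  qed
  moreover have "\<dots> \<in> sets borel" by measurable
  ultimately show ?thesis by simp
qed

section \<open>Escaping points in the Fatou set\<close>

text \<open>
  For nonconstant entire \<open>f\<close> this is the set of escaping points that lie in the Fatou set. In this
  form its openness and, by the open mapping theorem, its forward invariance are immediate.
\<close>
definition unif_escaping_set :: "(complex \<Rightarrow> complex) \<Rightarrow> complex set" where
  "unif_escaping_set f =
     {z. \<exists>\<delta>>0. \<forall>B. \<forall>\<^sub>F n in sequentially. \<forall>\<zeta>\<in>ball z \<delta>. B \<le> cmod ((f ^^ n) \<zeta>)}"

lemma infinite_nat_subseq:
  fixes P :: "nat \<Rightarrow> bool"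
  assumes "infinite {n. P n}"
  obtains s :: "nat \<Rightarrow> nat" where "strict_mono s" "\<And>k. P (s k)"
proof -
  obtain s :: "nat \<Rightarrow> nat" where "strict_mono s" "\<forall>n. s n \<in> {n. P n}"
    using infinite_enumerate[OF assms] by blast
  then show thesis using that by simp
qed

text \<open>
  A holomorphic limit function is impossible on a domain that contains an escaping point, so every
  subsequence of the iterates has a further subsequence tending to infinity locally uniformly.
\<close>
lemma normal_escaping_uniformly:
  assumes norm: "normal_family_on U (range (\<lambda>n. f ^^ n))"
    and u: "u \<in> U" "u \<in> escaping_set f" and K: "compact K" "K \<subseteq> U"
  shows "\<forall>\<^sub>F n in sequentially. \<forall>z\<in>K. B \<le> cmod ((f ^^ n) z)"
proof (rule ccontr)
  assume "\<not> ?thesis"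
  then have "infinite {n. \<exists>z\<in>K. cmod ((f ^^ n) z) < B}"
    by (simp add: eventually_cofinite flip: cofinite_eq_sequentially) (simp add: not_le)
  from infinite_nat_subseq[OF this]
  obtain s :: "nat \<Rightarrow> nat" where s: "strict_mono s" "\<And>k. \<exists>z\<in>K. cmod ((f ^^ s k) z) < B"
    by blast
  define h where "h k = f ^^ s k" for k
  have "range h \<subseteq> range (\<lambda>n. f ^^ n)" by (auto simp: h_def)
  then obtain r :: "nat \<Rightarrow> nat" where r: "strict_mono r" and alt:
    "(\<exists>g. g holomorphic_on U \<and> (\<forall>K. compact K \<and> K \<subseteq> U \<longrightarrow> uniform_limit K (h \<circ> r) g sequentially)) \<or>
     (\<forall>K. compact K \<and> K \<subseteq> U \<longrightarrow> (\<forall>B. \<forall>\<^sub>F n in sequentially. \<forall>z\<in>K. B \<le> cmod (h (r n) z)))"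
    using norm unfolding normal_family_on_def by blast
  from alt show False
  proof
    assume "\<exists>g. g holomorphic_on U \<and> (\<forall>K. compact K \<and> K \<subseteq> U \<longrightarrow> uniform_limit K (h \<circ> r) g sequentially)"
    moreover have "compact {u} \<and> {u} \<subseteq> U" using u(1) by simp
    ultimately obtain g where "uniform_limit {u} (h \<circ> r) g sequentially" by meson
    then have lim: "(\<lambda>n. (h \<circ> r) n u) \<longlonglongrightarrow> g u" by (rule tendsto_uniform_limitI) simp
    have "filterlim (\<lambda>n. s (r n)) at_top sequentially"
      using filterlim_subseq[OF strict_mono_o[OF s(1) r]] by (simp add: o_def)
    with u(2) have "filterlim (\<lambda>n. (f ^^ s (r n)) u) at_infinity sequentially"
      unfolding escaping_set_def by (auto intro: filterlim_compose)
    then have "filterlim (\<lambda>n. (h \<circ> r) n u) at_infinity sequentially" by (simp add: h_def)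
    with lim show False
      using not_tendsto_and_filterlim_at_infinity by (metis sequentially_bot)
  next
    assume "\<forall>K. compact K \<and> K \<subseteq> U \<longrightarrow> (\<forall>B. \<forall>\<^sub>F n in sequentially. \<forall>z\<in>K. B \<le> cmod (h (r n) z))"
    then have "\<forall>\<^sub>F n in sequentially. \<forall>z\<in>K. B \<le> cmod (h (r n) z)" using K by blast
    then obtain n where "\<forall>z\<in>K. B \<le> cmod (h (r n) z)"
      using eventually_happens'[OF sequentially_bot] by blast
    then show False using s(2)[of "r n"] by (auto simp: h_def not_le)
  qed
qed

lemma normal_escaping_subset:
  assumes "open U" "normal_family_on U (range (\<lambda>n. f ^^ n))" "u \<in> U" "u \<in> escaping_set f"
  shows "U \<subseteq> unif_escaping_set f"
proof
  fix z assume "z \<in> U"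
  then obtain e where e: "e > 0" "cball z e \<subseteq> U"
    using assms(1) open_contains_cball by blast
  have "\<forall>\<^sub>F n in sequentially. \<forall>\<zeta>\<in>ball z e. B \<le> cmod ((f ^^ n) \<zeta>)" for B
    using normal_escaping_uniformly[OF assms(2-4) compact_cball e(2), of B]
    by (rule eventually_mono) auto
  then show "z \<in> unif_escaping_set f"
    unfolding unif_escaping_set_def using e(1) by blast
qed

lemma unif_escaping_subset_escaping: "unif_escaping_set f \<subseteq> escaping_set f"
proof
  fix z assume "z \<in> unif_escaping_set f"
  then obtain d where "d > 0" and d: "\<And>B. \<forall>\<^sub>F n in sequentially. \<forall>\<zeta>\<in>ball z d. B \<le> cmod ((f ^^ n) \<zeta>)"
    unfolding unif_escaping_set_def by blast
  have "\<forall>\<^sub>F n in sequentially. B \<le> cmod ((f ^^ n) z)" for B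
    using d[of B] by (rule eventually_mono) (use \<open>d > 0\<close> in auto)
  then show "z \<in> escaping_set f"
    unfolding escaping_set_def by (simp add: filterlim_at_infinity[of 0])
qed

lemma escaping_Fatou_subset: "escaping_set f \<inter> Fatou_set f \<subseteq> unif_escaping_set f"
  using normal_escaping_subset unfolding Fatou_set_def by blast

lemma open_unif_escaping: "open (unif_escaping_set f)"
  unfolding open_contains_ball
proof
  fix z assume "z \<in> unif_escaping_set f"
  then obtain d where d: "d > 0" "\<And>B. \<forall>\<^sub>F n in sequentially. \<forall>\<zeta>\<in>ball z d. B \<le> cmod ((f ^^ n) \<zeta>)"
    unfolding unif_escaping_set_def by blast
  have "ball z d \<subseteq> unif_escaping_set f"
  proof
    fix x assume "x \<in> ball z d"
    then obtain e where e: "e > 0" "ball x e \<subseteq> ball z d"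
      using openE[OF open_ball] by blast
    have "\<forall>\<^sub>F n in sequentially. \<forall>\<zeta>\<in>ball x e. B \<le> cmod ((f ^^ n) \<zeta>)" for B
      using d(2)[of B] by (rule eventually_mono) (use e in auto)
    then show "x \<in> unif_escaping_set f" unfolding unif_escaping_set_def using e(1) by blast
  qed
  then show "\<exists>e>0. ball z e \<subseteq> unif_escaping_set f" using d(1) by blast
qed

lemma open_Fatou: "open (Fatou_set f)"
  unfolding open_subopen[of "Fatou_set f"] unfolding Fatou_set_def by blast

lemma holomorphic_iterates:
  assumes "f holomorphic_on UNIV" shows "(f ^^ n) holomorphic_on UNIV"
proof (induction n)
  case (Suc n)
  then show ?case
    using holomorphic_on_compose_gen[OF Suc assms] by (simp add: o_def)
qed (simp add: id_def)

text \<open>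
  A sequence of iterates either repeats one iterate infinitely often, giving a constant subsequence,
  or its exponents tend to infinity, giving locally uniform divergence.
\<close>
lemma unif_escaping_subset_Fatou:
  assumes f: "f holomorphic_on UNIV"
  shows "unif_escaping_set f \<subseteq> Fatou_set f"
proof
  fix z assume "z \<in> unif_escaping_set f"
  then obtain d where "d > 0" and d: "\<And>B. \<forall>\<^sub>F n in sequentially. \<forall>\<zeta>\<in>ball z d. B \<le> cmod ((f ^^ n) \<zeta>)"
    unfolding unif_escaping_set_def by blast
  have "normal_family_on (ball z d) (range (\<lambda>n. f ^^ n))"
    unfolding normal_family_on_def
  proof (intro allI impI)
    fix h :: "nat \<Rightarrow> complex \<Rightarrow> complex" assume "range h \<subseteq> range (\<lambda>n. f ^^ n)"
    then have "\<forall>k. \<exists>m. h k = f ^^ m" by blast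
    then obtain m where m: "\<And>k. h k = f ^^ m k" by metis
    show "\<exists>r::nat \<Rightarrow> nat. strict_mono r \<and>
           ((\<exists>g. g holomorphic_on ball z d \<and>
                 (\<forall>K. compact K \<and> K \<subseteq> ball z d \<longrightarrow> uniform_limit K (h \<circ> r) g sequentially)) \<or>
            (\<forall>K. compact K \<and> K \<subseteq> ball z d \<longrightarrow>
                 (\<forall>B. \<forall>\<^sub>F n in sequentially. \<forall>z\<in>K. B \<le> cmod (h (r n) z))))"
    proof (cases "\<exists>j. infinite {k. m k = j}")
      case True
      then obtain j where "infinite {k. m k = j}" by blast
      from infinite_nat_subseq[OF this]
      obtain r :: "nat \<Rightarrow> nat" where r: "strict_mono r" "\<And>k. m (r k) = j"
        by blast
      have "h \<circ> r = (\<lambda>_. f ^^ j)" using r(2) by (auto simp: m)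
      then have "uniform_limit K (h \<circ> r) (f ^^ j) sequentially" for K
        by (simp add: uniform_limit_const)
      moreover have "(f ^^ j) holomorphic_on ball z d"
        using holomorphic_iterates[OF f] by (rule holomorphic_on_subset) simp
      ultimately show ?thesis using r(1) by blast
    next
      case False
      have top: "filterlim m at_top sequentially"
        unfolding filterlim_at_top
      proof
        fix M
        have "{k. \<not> M \<le> m k} = (\<Union>j<M. {k. m k = j})" by auto
        moreover have "finite \<dots>" using False by blast
        ultimately have "finite {k. \<not> M \<le> m k}" by simp
        then show "\<forall>\<^sub>F k in sequentially. M \<le> m k"
          by (simp add: eventually_cofinite flip: cofinite_eq_sequentially)
      qed
      have "\<forall>\<^sub>F n in sequentially. \<forall>z\<in>K. B \<le> cmod (h (id n) z)" if "K \<subseteq> ball z d" for K B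
        using filterlim_iff[THEN iffD1, OF top, rule_format, OF d[of B]]
        by (rule eventually_mono) (use that in \<open>auto simp: m\<close>)
      then show ?thesis using strict_mono_id by blast
    qed
  qed
  then show "z \<in> Fatou_set f"
    unfolding Fatou_set_def using \<open>d > 0\<close> by (intro CollectI exI[of _ "ball z d"]) auto
qed

lemma unif_escaping_invariant:
  assumes f: "f holomorphic_on UNIV" "\<not> f constant_on UNIV" and z: "z \<in> unif_escaping_set f"
  shows "f z \<in> unif_escaping_set f"
proof -
  from z obtain d where "d > 0" and d: "\<And>B. \<forall>\<^sub>F n in sequentially. \<forall>\<zeta>\<in>ball z d. B \<le> cmod ((f ^^ n) \<zeta>)"
    unfolding unif_escaping_set_def by blast
  have "open (f ` ball z d)"
    by (rule open_mapping_thm[OF f(1) _ _ _ _ f(2)]) auto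
  moreover have "f z \<in> f ` ball z d" using \<open>d > 0\<close> by simp
  ultimately obtain e where e: "e > 0" "ball (f z) e \<subseteq> f ` ball z d"
    using open_contains_ball by blast
  have "\<forall>\<^sub>F n in sequentially. \<forall>\<zeta>\<in>ball (f z) e. B \<le> cmod ((f ^^ n) \<zeta>)" for B
  proof -
    have "\<forall>\<^sub>F n in sequentially. \<forall>\<zeta>\<in>ball z d. B \<le> cmod ((f ^^ Suc n) \<zeta>)"
      using d[of B] eventually_sequentially_Suc[of "\<lambda>n. \<forall>\<zeta>\<in>ball z d. B \<le> cmod ((f ^^ n) \<zeta>)"]
      by simp
    then show ?thesis
    proof (rule eventually_mono)
      fix n assume *: "\<forall>\<zeta>\<in>ball z d. B \<le> cmod ((f ^^ Suc n) \<zeta>)"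
      show "\<forall>\<zeta>\<in>ball (f z) e. B \<le> cmod ((f ^^ n) \<zeta>)"
      proof
        fix \<zeta> assume "\<zeta> \<in> ball (f z) e"
        then obtain x where "x \<in> ball z d" "\<zeta> = f x" using e by blast
        then show "B \<le> cmod ((f ^^ n) \<zeta>)" using * by (simp add: funpow_swap1)
      qed
    qed
  qed
  then show ?thesis unfolding unif_escaping_set_def using e(1) by blast
qed

text \<open>
  If every point were normal, local uniform escape would spread from one point to the whole connected
  plane. But \<open>f \<circ> f\<close> has a fixed point, and its orbit does not escape.
\<close>
lemma Julia_nonempty_if_unif_escaping:
  assumes f: "transcendental_entire f" and ne: "unif_escaping_set f \<noteq> {}"
  shows "Fatou_set f \<noteq> UNIV"
proof
  assume F: "Fatou_set f = UNIV"
  have "closed (unif_escaping_set f)"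
    unfolding closed_def open_subopen[of "- unif_escaping_set f"]
  proof
    fix z assume z: "z \<in> - unif_escaping_set f"
    obtain U where U: "open U" "z \<in> U" "normal_family_on U (range (\<lambda>n. f ^^ n))"
      using F unfolding Fatou_set_def by blast
    have "U \<inter> unif_escaping_set f = {}"
      using normal_escaping_subset[OF U(1,3)] unif_escaping_subset_escaping[of f] z U(2) by blast
    then show "\<exists>T. open T \<and> z \<in> T \<and> T \<subseteq> - unif_escaping_set f" using U by blast
  qed
  then have all: "unif_escaping_set f = UNIV"
    using open_unif_escaping[of f] ne clopen by blast
  have "f \<noteq> (\<lambda>x. a + x)" for a
  proof
    assume "f = (\<lambda>x. a + x)"
    then have "f z = poly [:a, 1:] z" for z by simp
    then show False using f unfolding transcendental_entire_def by blast
  qed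
  then obtain x where x: "f (f x) = x"
    using holomorphic_involution_point[of f] f unfolding transcendental_entire_def by metis
  have it: "(f ^^ (2 * n)) x = x" for n
    using x by (induction n) auto
  have "x \<in> escaping_set f" using all unif_escaping_subset_escaping by blast
  then have "filterlim (\<lambda>n. (f ^^ n) x) at_infinity sequentially" by (simp add: escaping_set_def)
  moreover have "filterlim (\<lambda>n::nat. 2 * n) at_top sequentially"
    by (rule filterlim_subseq) (simp add: strict_mono_def)
  ultimately have "filterlim (\<lambda>n. (f ^^ (2 * n)) x) at_infinity sequentially"
    by (rule filterlim_compose)
  then show False unfolding it
    using not_tendsto_and_filterlim_at_infinity[of sequentially "\<lambda>_. x" x] by simp
qed

text \<open>
  A Koebe-type estimate. On \<open>U\<close> there is a holomorphic branch \<open>L\<close> of \<open>log (w - a)\<close>. Its image contains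
  no two distinct points that differ by \<open>2 \<pi> \<i>\<close>, because \<open>exp\<close> would identify them, so it contains no
  disk of radius larger than \<open>2 \<pi>\<close>. By Bloch's theorem the derivative of \<open>L \<circ> g\<close> is bounded.
\<close>
lemma simply_connected_log_deriv_bound:
  assumes U: "open U" "simply_connected U" "a \<notin> U"
    and g: "g holomorphic_on ball z d" "g ` ball z d \<subseteq> U" and d: "d > 0"
  shows "d * cmod (deriv g z) \<le> 24 * pi * cmod (g z - a)"
proof -
  have "(\<lambda>w. w - a) holomorphic_on U \<and> (\<forall>w\<in>U. w - a \<noteq> 0)"
    using U(3) by (auto intro!: holomorphic_intros)
  then have "\<exists>L. L holomorphic_on U \<and> (\<forall>w\<in>U. w - a = exp (L w))"
    by (rule simply_connected_eq_holomorphic_log[OF U(1), THEN iffD1, OF U(2), THEN conjunct2, rule_format])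
  then obtain L where L: "L holomorphic_on U" "\<And>w. w \<in> U \<Longrightarrow> w - a = exp (L w)"
    by blast
  define h where "h = L \<circ> g"
  have h: "h holomorphic_on ball z d"
    unfolding h_def by (rule holomorphic_on_compose_gen[OF g(1) L(1) g(2)])
  have eh: "exp (h x) = g x - a" if "x \<in> ball z d" for x
  proof -
    have "g x \<in> U" using g(2) that by blast
    then show ?thesis using L(2)[of "g x"] by (simp add: h_def)
  qed
  have small: "d * cmod (deriv h z) / 12 \<le> 2 * pi"
  proof (rule ccontr)
    assume big: "\<not> ?thesis"
    obtain b where b: "ball b (d * cmod (deriv h z) / 12) \<subseteq> h ` ball z d"
      using Bloch[OF h d order_refl] by metis
    have rad: "2 * pi < d * cmod (deriv h z) / 12" using big by simp
    then have "0 < d * cmod (deriv h z) / 12" using pi_gt_zero by linarith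
    then have "b \<in> ball b (d * cmod (deriv h z) / 12)"
      by (simp only: centre_in_ball)
    moreover have "b + 2 * pi * \<i> \<in> ball b (d * cmod (deriv h z) / 12)"
      using rad by (simp add: dist_norm norm_mult)
    ultimately have "b \<in> h ` ball z d" "b + 2 * pi * \<i> \<in> h ` ball z d"
      using b by blast+
    then obtain x y where xy: "x \<in> ball z d" "h x = b" "y \<in> ball z d" "h y = b + 2 * pi * \<i>"
      by (metis imageE)
    then have "exp (h x) = exp (h y)" by (simp add: exp_add)
    then have "g x = g y" unfolding eh[OF xy(1)] eh[OF xy(3)] by simp
    then have "h x = h y" by (simp add: h_def)
    then show False using xy by simp
  qed
  have zb: "z \<in> ball z d" using d by simp
  have "((\<lambda>x. exp (h x)) has_field_derivative exp (h z) * deriv h z) (at z)"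
    using h zb by (auto intro!: derivative_eq_intros holomorphic_derivI)
  then have "((\<lambda>x. g x - a) has_field_derivative exp (h z) * deriv h z) (at z)"
    by (rule has_field_derivative_transform_within_open[OF _ open_ball zb]) (use eh in auto)
  moreover have "((\<lambda>x. g x - a) has_field_derivative deriv g z) (at z)"
    using g(1) zb by (auto intro!: derivative_eq_intros holomorphic_derivI)
  ultimately have "deriv g z = (g z - a) * deriv h z"
    using DERIV_unique eh[OF zb] by metis
  then have "d * cmod (deriv g z) = cmod (g z - a) * (d * cmod (deriv h z))"
    by (simp add: norm_mult)
  also have "\<dots> \<le> cmod (g z - a) * (24 * pi)"
    using small by (intro mult_left_mono) auto
  finally show ?thesis by (simp add: mult.commute)
qed

lemma iterate_image_unif_escaping:
  assumes f: "f holomorphic_on UNIV" "\<not> f constant_on UNIV" and D: "D \<subseteq> unif_escaping_set f"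
  shows "(f ^^ n) ` D \<subseteq> unif_escaping_set f"
proof (induction n)
  case (Suc n)
  then have "f ` (f ^^ n) ` D \<subseteq> unif_escaping_set f"
    using unif_escaping_invariant[OF f] by blast
  then show ?case by (simp add: image_comp)
qed (use D in simp)

text \<open>
  All iterates map a fixed disk about \<open>z\<close> into simply connected components of the Fatou set, and all
  these components omit the same point \<open>a\<close> of the Julia set. Hence the Koebe-type estimate holds with
  one constant for all iterates.
\<close>
lemma iterate_deriv_bound:
  assumes f: "transcendental_entire f"
    and sc: "\<And>U. U \<in> components (Fatou_set f) \<Longrightarrow> simply_connected U"
    and z: "z \<in> unif_escaping_set f"
  obtains a C where "C > 0" "\<And>n. cmod (deriv (f ^^ n) z) \<le> C * cmod ((f ^^ n) z - a)"
proof -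
  have holf: "f holomorphic_on UNIV" using f by (simp add: transcendental_entire_def)
  have nc: "\<not> f constant_on UNIV" using transcendental_nonconstant[OF f, of 0] by simp
  obtain a where a: "a \<notin> Fatou_set f"
    using Julia_nonempty_if_unif_escaping[OF f] z by blast
  obtain d where d: "d > 0" "ball z d \<subseteq> unif_escaping_set f"
    using open_unif_escaping z open_contains_ball by blast
  have "cmod (deriv (f ^^ n) z) \<le> 24 * pi / d * cmod ((f ^^ n) z - a)" for n
  proof -
    let ?g = "f ^^ n"
    have hol: "?g holomorphic_on ball z d"
      using holomorphic_iterates[OF holf] by (rule holomorphic_on_subset) simp
    define U where "U = connected_component_set (Fatou_set f) (?g z)"
    have sub: "?g ` ball z d \<subseteq> Fatou_set f"
      using iterate_image_unif_escaping[OF holf nc d(2)] unif_escaping_subset_Fatou[OF holf] by blast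
    have gz: "?g z \<in> ?g ` ball z d" using d(1) by simp
    have "U \<in> components (Fatou_set f)"
      unfolding U_def using sub gz by (intro componentsI) blast
    moreover have "open U" unfolding U_def by (intro open_connected_component open_Fatou)
    moreover have "a \<notin> U" using a connected_component_subset unfolding U_def by blast
    moreover have "?g ` ball z d \<subseteq> U"
      unfolding U_def using sub gz
      by (intro connected_component_maximal connected_continuous_image
           holomorphic_on_imp_continuous_on hol) auto
    ultimately have "d * cmod (deriv ?g z) \<le> 24 * pi * cmod (?g z - a)"
      using sc d(1) hol by (intro simply_connected_log_deriv_bound[of U])
    then show ?thesis using d(1) by (simp add: field_simps)
  qed
  then show thesis using that[of "24 * pi / d" a] d(1) by simp
qed

text \<open>The chain rule in logarithmic coordinates.\<close>
lemma iterate_log_deriv: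
  assumes f: "f holomorphic_on UNIV" and nz: "\<And>j. f ((f ^^ j) z) \<noteq> 0"
  shows "z * deriv (f ^^ n) z =
    (f ^^ n) z * (\<Prod>j<n. (f ^^ j) z * deriv f ((f ^^ j) z) / f ((f ^^ j) z))"
proof (induction n)
  case 0
  have "deriv (\<lambda>x::complex. x) z = 1" by simp
  then show ?case by (simp add: id_def)
next
  case (Suc n)
  let ?w = "(f ^^ n) z"
  have "((f \<circ> (f ^^ n)) has_field_derivative deriv f ?w * deriv (f ^^ n) z) (at z)"
    using holomorphic_derivI[OF f open_UNIV UNIV_I]
      holomorphic_derivI[OF holomorphic_iterates[OF f] open_UNIV UNIV_I]
    by (intro DERIV_chain) auto
  then have "deriv (f ^^ Suc n) z = deriv f ?w * deriv (f ^^ n) z"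
    by (simp add: DERIV_imp_deriv)
  then have "z * deriv (f ^^ Suc n) z = deriv f ?w * (z * deriv (f ^^ n) z)" by simp
  also have "\<dots> = f ?w * (?w * deriv f ?w / f ?w) * (\<Prod>j<n. (f ^^ j) z * deriv f ((f ^^ j) z) / f ((f ^^ j) z))"
    unfolding Suc.IH using nz[of n] by simp
  finally show ?case by (simp add: mult_ac o_def nz)
qed

text \<open>
  For an escaping Fatou point, \<open>(f^n)'(z)\<close> is bounded by a multiple of \<open>\<bar>f^n(z) - a\<bar>\<close>, which is at
  most \<open>2 \<bar>f^n(z)\<bar>\<close> for large \<open>n\<close>. So the logarithmic derivative of \<open>f^n\<close> at \<open>z\<close> stays bounded, whereas by the chain rule it is at least \<open>2^n\<close>.
\<close>
lemma expanding_escaping_in_Julia: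
  assumes f: "transcendental_entire f"
    and sc: "\<And>U. U \<in> components (Fatou_set f) \<Longrightarrow> simply_connected U"
    and z: "z \<in> escaping_set f"
    and nz: "\<And>j. f ((f ^^ j) z) \<noteq> 0"
    and expand: "\<And>j. 2 \<le> cmod ((f ^^ j) z * deriv f ((f ^^ j) z) / f ((f ^^ j) z))"
  shows "z \<in> Julia_set f"
proof (rule ccontr)
  assume "z \<notin> Julia_set f"
  then have "z \<in> unif_escaping_set f"
    using z escaping_Fatou_subset[of f] by (auto simp: Julia_set_def)
  from iterate_deriv_bound[OF f sc this]
  obtain a C where C: "C > 0" "\<And>n. cmod (deriv (f ^^ n) z) \<le> C * cmod ((f ^^ n) z - a)"
    by blast
  have holf: "f holomorphic_on UNIV" using f by (simp add: transcendental_entire_def)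
  have big: "\<forall>\<^sub>F n in sequentially. B \<le> cmod ((f ^^ n) z)" for B
    using z unfolding escaping_set_def by (simp add: filterlim_at_infinity_conv_norm_at_top filterlim_at_top)
  have "\<forall>\<^sub>F n in sequentially. 2 ^ n \<le> 2 * C * cmod z"
    using big[of "cmod a"] big[of 1]
  proof eventually_elim
    case (elim n)
    let ?P = "\<Prod>j<n. (f ^^ j) z * deriv f ((f ^^ j) z) / f ((f ^^ j) z)"
    have "(2::real) ^ n = (\<Prod>j<n. 2)" by simp
    also have "\<dots> \<le> (\<Prod>j<n. cmod ((f ^^ j) z * deriv f ((f ^^ j) z) / f ((f ^^ j) z)))"
      using expand by (intro prod_mono) auto
    also have "\<dots> = cmod ?P" by (rule prod_norm)
    finally have "cmod ((f ^^ n) z) * 2 ^ n \<le> cmod ((f ^^ n) z) * cmod ?P"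
      by (intro mult_left_mono) auto
    also have "\<dots> = cmod z * cmod (deriv (f ^^ n) z)"
      using arg_cong[OF iterate_log_deriv[OF holf nz, of n], of cmod] by (simp only: norm_mult)
    also have "\<dots> \<le> cmod z * (C * (2 * cmod ((f ^^ n) z)))"
    proof (intro mult_left_mono order_trans[OF C(2)])
      show "cmod ((f ^^ n) z - a) \<le> 2 * cmod ((f ^^ n) z)"
        using norm_triangle_ineq4[of "(f ^^ n) z" a] elim by linarith
    qed (use C in auto)
    finally have "cmod ((f ^^ n) z) * 2 ^ n \<le> cmod ((f ^^ n) z) * (2 * C * cmod z)"
      by (simp add: mult_ac)
    then show ?case using elim by (subst (asm) mult_le_cancel_left_pos) auto
  qed
  moreover have "\<forall>\<^sub>F n in sequentially. 2 * C * cmod z < 2 ^ n"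
  proof -
    have "filterlim (\<lambda>n::nat. (2::real) ^ n) at_top sequentially" by real_asymp
    then show ?thesis by (simp add: filterlim_at_top_dense)
  qed
  ultimately have "\<forall>\<^sub>F n in sequentially. False"
    by eventually_elim simp
  then show False by simp
qed

section \<open>Logarithmic area of the escaping set\<close>

theorem theorem1p3:
  fixes f :: "complex \<Rightarrow> complex" and \<epsilon> :: real
  assumes "transcendental_entire f"
    and "\<epsilon> > 0"
    and "logarea {z \<in> Delta.
           cmod (z * deriv f z / f z) < real (max_num_pts f (cmod z)) powr (1 / 2 + \<epsilon>) \<or>
           cmod (f z) < (1 + \<epsilon>) * cmod z} < \<infinity>"
  shows "logarea (Delta - escaping_set f) < \<infinity> \<and>
         area (escaping_set f) > 0 \<and>
         (\<not> (\<exists>U \<in> components (Fatou_set f). multiply_connected U) \<longrightarrow>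
            logarea (Delta - (escaping_set f \<inter> Julia_set f)) < \<infinity> \<and>
            area (escaping_set f \<inter> Julia_set f) > 0)"
proof -
  note f = assms(1) and \<epsilon> = assms(2)
  have hol: "f holomorphic_on UNIV" using f by (simp add: transcendental_entire_def)
  have "logarea (exceptional_set f \<epsilon>) < \<infinity>" using assms(3) by (simp only: exceptional_set_def)
  then obtain R where R: "1 \<le> R" "4 \<le> max_num_pts f R"
    and fin: "logarea (Delta - good_orbits f \<epsilon> R) < \<infinity>"
    by (rule good_orbits_cofinite[OF f \<epsilon>])
  let ?X = "good_orbits f \<epsilon> R"
  have conclude: "logarea (Delta - S) < \<infinity> \<and> area S > 0" if "S \<in> sets borel" "?X \<subseteq> S" for S
  proof -
    have "logarea (Delta - S) \<le> logarea (Delta - ?X)"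
      using that(2) by (intro logarea_mono) blast
    then have "logarea (Delta - S) < \<infinity>" using fin by (rule le_less_trans)
    then show ?thesis using area_pos_if_logarea_complement_finite[OF that(1)] by blast
  qed
  have I: "escaping_set f \<in> sets borel" by (rule escaping_set_borel[OF hol])
  have XI: "?X \<subseteq> escaping_set f" by (rule good_orbits_escaping[OF R(1) \<epsilon>])
  have "logarea (Delta - (escaping_set f \<inter> Julia_set f)) < \<infinity> \<and> area (escaping_set f \<inter> Julia_set f) > 0"
    if nm: "\<not> (\<exists>U \<in> components (Fatou_set f). multiply_connected U)"
  proof (rule conclude)
    have "Fatou_set f \<in> sets borel" using open_Fatou by (rule borel_open)
    then show "escaping_set f \<inter> Julia_set f \<in> sets borel"
      using I unfolding Julia_set_def by (intro sets.Int sets.Diff) auto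
    have sc: "simply_connected U" if "U \<in> components (Fatou_set f)" for U
      using nm that in_components_connected unfolding multiply_connected_def by blast
    show "?X \<subseteq> escaping_set f \<inter> Julia_set f"
    proof
      fix z assume z: "z \<in> ?X"
      have expand: "2 \<le> cmod ((f ^^ j) z * deriv f ((f ^^ j) z) / f ((f ^^ j) z))" for j
        by (rule good_orbits_expand[OF f R \<epsilon> z])
      have nz: "f ((f ^^ j) z) \<noteq> 0" for j
        using expand[of j] by (cases "f ((f ^^ j) z) = 0") simp_all
      have "z \<in> escaping_set f" using XI z by blast
      then show "z \<in> escaping_set f \<inter> Julia_set f"
        using expanding_escaping_in_Julia[OF f sc _ nz expand] by blast
    qed
  qed
  then show ?thesis using conclude[OF I XI] by blast
qed

end
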